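(* There are positive constants $C_1$ and $C_2$ such that, for all integers $n\ge3$, $$C_1\,\frac{n}{\log\log n}<N^*_{root}(-n)<C_2\,n\log\log n.$$
   Context: An integer Descartes quadruple is $(a,b,c,d)\in\mathbb Z^4$ with $2(a^2+b^2+c^2+d^2)=(a+b+c+d)^2$; it is primitive if $\gcd(a,b,c,d)=1$. A Descartes quadruple with $a+b+c+d>0$ is a root quadruple if $a\le0\le b\le c\le d$ and $a+b+c\ge d$. $N^*_{root}(-n)$ is the number of primitive integer root quadruples $(a,b,c,d)$ with $a=-n$. *)

theory Defs
  imports Complex_Main
begin

definition descartes_quadruple :: "int \<times> int \<times> int \<times> int \<Rightarrow> bool" where
  "descartes_quadruple = (\<lambda>(a, b, c, d).
     2 * (a\<^sup>2 + b\<^sup>2 + c\<^sup>2 + d\<^sup>2) = (a + b + c + d)\<^sup>2)"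

definition primitive_quadruple :: "int \<times> int \<times> int \<times> int \<Rightarrow> bool" where
  "primitive_quadruple = (\<lambda>(a, b, c, d). Gcd {a, b, c, d} = 1)"

definition root_quadruple :: "int \<times> int \<times> int \<times> int \<Rightarrow> bool" where
  "root_quadruple = (\<lambda>(a, b, c, d).
     descartes_quadruple (a, b, c, d) \<and> a + b + c + d > 0 \<and>
     a \<le> 0 \<and> 0 \<le> b \<and> b \<le> c \<and> c \<le> d \<and> a + b + c \<ge> d)"

(* The argument is the smallest entry a itself, so the count for a = -n is N_root_star (-n).
   For a < 0 the set is finite: with x = a + b, y = a + c, z = a + d the Descartes
   equation becomes 4 * (x * y - a^2) = (x + y - z)^2, and the root inequalities then
   bound b, c and d in terms of a. *)
definition N_root_star :: "int \<Rightarrow> nat" where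
  "N_root_star m = card {(a, b, c, d).
     root_quadruple (a, b, c, d) \<and> primitive_quadruple (a, b, c, d) \<and> a = m}"

end

theory Submission
  imports Defs "HOL-Number_Theory.Number_Theory"
begin

text \<open>
  With \<open>x = b - n\<close>, \<open>y = c - n\<close>, root quadruples with \<open>a = - n\<close> become the reduced binary quadratic
  forms \<open>[x, 2 m, y]\<close> with \<open>x y = n\<^sup>2 + m\<^sup>2\<close> and \<open>0 \<le> 2 m \<le> x \<le> y\<close>. A primitive such form is
  the Gram matrix of two vectors in \<open>\<int>\<^sup>2\<close> of determinant \<open>n\<close>. Hence \<open>x = p\<^sup>2 + q\<^sup>2 \<le> 2 n\<close>, where
  \<open>g = gcd p q\<close> divides \<open>n\<close>, and \<open>(p, q)\<close> leaves at most \<open>g\<close> choices for \<open>m\<close>, so the number of forms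
  is \<open>O(n \<Sum>\<^bsub>g | n\<^esub> 1 / g)\<close>. Conversely each of the at least \<open>\<phi>(n)\<^sup>2\<close> pairs \<open>(u, v)\<close> modulo \<open>n\<close> with
  \<open>u\<^sup>2 + v\<^sup>2\<close> a unit spans, together with \<open>n \<int>\<^sup>2\<close>, a lattice with a reduced basis, and a form arises
  from at most \<open>8 \<phi>(n)\<close> pairs, because lattices with the same form differ by a Gaussian unit. Both
  \<open>n / \<phi>(n)\<close> and \<open>\<Sum>\<^bsub>g | n\<^esub> 1 / g\<close> are at most \<open>\<Prod>\<^bsub>p | n\<^esub> (1 - 1 / p)\<^sup>-\<^sup>1 = O(log log n)\<close>; for this
  the primes up to \<open>x = log n\<close> are compared with the zeta function at \<open>1 + 1 / log x\<close>.
\<close>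

section \<open>The product of \<open>p / (p - 1)\<close> over the primes dividing \<open>n\<close>\<close>

lemma sum_inverse_squares_le:
  assumes "finite A" "\<And>k. k \<in> A \<Longrightarrow> k \<ge> (2::nat)"
  shows "(\<Sum>k\<in>A. 1 / (real k)\<^sup>2) \<le> 1"
proof -
  \<comment> \<open>Each term is at most 1/(k-1) - 1/k, so the sum from 2 telescopes.\<close>
  have telescope: "(\<Sum>k=2..N. 1 / (real k)\<^sup>2) \<le> 1 - 1 / real N" if "N \<ge> 1" for N
    using that
  proof (induction N rule: dec_induct)
    case (step N)
    have "1 / (real (Suc N))\<^sup>2 \<le> 1 / (real N * real (Suc N))"
      using step by (intro frac_le) (auto simp: power2_eq_square)
    also have "\<dots> = 1 / real N - 1 / real (Suc N)" using step by (simp add: field_simps)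
    finally have "1 / (real (Suc N))\<^sup>2 \<le> 1 / real N - 1 / real (Suc N)" .
    then show ?case using step by simp
  qed simp
  obtain N where N: "\<forall>k\<in>A. k \<le> N" using assms(1) finite_nat_set_iff_bounded_le by blast
  have "(\<Sum>k\<in>A. 1 / (real k)\<^sup>2) \<le> (\<Sum>k=2..Suc N. 1 / (real k)\<^sup>2)"
    using N assms by (intro sum_mono2) (auto simp: le_SucI)
  also have "\<dots> \<le> 1 - 1 / real (Suc N)" by (rule telescope) simp
  also have "\<dots> \<le> 1" by simp
  finally show ?thesis .
qed

text \<open>A discrete integral test for zeta at 1 + \<epsilon>, uniform in \<open>N\<close>.
  Bernoulli's inequality in the form 1 + \<epsilon>/a \<le> (1 - 1/a) powr (-\<epsilon>) bounds each
  term by a difference of consecutive values of k powr (-\<epsilon>) / \<epsilon>.\<close>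

lemma sum_powr_le:
  assumes "\<epsilon> > (0::real)"
  shows "(\<Sum>k=1..N. real k powr (- (1 + \<epsilon>))) \<le> 1 + 1 / \<epsilon>"
proof -
  \<comment> \<open>The bound is strengthened by the tail of the integral, since without it the
    induction would not close.\<close>
  have telescope: "(\<Sum>k=1..N. real k powr (- (1 + \<epsilon>))) \<le> 1 + 1 / \<epsilon> - real N powr (-\<epsilon>) / \<epsilon>"
    if "N \<ge> 1" for N
    using that
  proof (induction N rule: dec_induct)
    case (step N)
    define a where "a = real (Suc N)"
    have a: "a \<ge> 2" "real N = a - 1" using step by (auto simp: a_def)
    have "ln (1 - 1 / a) \<le> - 1 / a"
      using ln_le_minus_one[of "1 - 1 / a"] a by (simp add: field_simps)
    then have "1 / a \<le> - ln (1 - 1 / a)" by simp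
    then have "\<epsilon> * (1 / a) \<le> \<epsilon> * (- ln (1 - 1 / a))" using assms by (intro mult_left_mono) auto
    also have "1 + \<dots> \<le> exp \<dots>" by (rule exp_ge_add_one_self)
    also have "\<dots> = (1 - 1 / a) powr (-\<epsilon>)" using a by (simp add: powr_def)
    finally have "1 + \<epsilon> * (1 / a) \<le> (1 - 1 / a) powr (-\<epsilon>)" by simp
    then have "a powr (-\<epsilon>) * (1 + \<epsilon> * (1 / a)) \<le> a powr (-\<epsilon>) * (1 - 1 / a) powr (-\<epsilon>)"
      by (intro mult_left_mono) auto
    also have "\<dots> = (a * (1 - 1 / a)) powr (-\<epsilon>)" using a by (subst powr_mult) auto
    also have "a * (1 - 1 / a) = real N" using a by (simp add: right_diff_distrib)
    finally have *: "a powr (-\<epsilon>) + \<epsilon> * (a powr (-\<epsilon>) / a) \<le> real N powr (-\<epsilon>)"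
      by (simp add: algebra_simps)
    have "a powr (- (1 + \<epsilon>)) = a powr (-\<epsilon>) / a"
      using a powr_add[of a "-1" "-\<epsilon>"] by (simp add: powr_minus field_simps)
    then have "a powr (- (1 + \<epsilon>)) \<le> real N powr (-\<epsilon>) / \<epsilon> - a powr (-\<epsilon>) / \<epsilon>"
      using * assms by (simp add: field_simps)
    then show ?case using step by (simp add: a_def)
  qed simp
  show ?thesis
  proof (cases "N \<ge> 1")
    case True
    have "real N powr (-\<epsilon>) / \<epsilon> \<ge> 0" using assms by simp
    then show ?thesis using telescope[OF True] by linarith
  qed (use assms in auto)
qed

text \<open>By unique factorization a set of primes is recovered as the prime factors of its
  product.\<close>

lemma prod_primes_inj_on: "inj_on (\<lambda>B. \<Prod>B) {B. finite B \<and> (\<forall>p\<in>B. prime (p::nat))}"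
proof (rule inj_onI)
  fix B C :: "nat set"
  assume B: "B \<in> {B. finite B \<and> (\<forall>p\<in>B. prime p)}" and C: "C \<in> {B. finite B \<and> (\<forall>p\<in>B. prime p)}"
    and eq: "\<Prod>B = \<Prod>C"
  have "prime_factors (\<Prod>X) = X" if "finite X" "\<forall>p\<in>X. prime p" for X :: "nat set"
    using that by (subst prime_factors_prod) (auto simp: prime_factorization_prime)
  then show "B = C" using B C eq by (metis (mono_tags, lifting) mem_Collect_eq)
qed

text \<open>Expanding the product gives one term for each subset of \<open>A\<close>. The products
  of these subsets are distinct positive integers, so the expansion is part of a partial sum of the
  zeta series.\<close>

lemma prod_primes_one_plus_powr_le:
  assumes "finite A" "\<And>p. p \<in> A \<Longrightarrow> prime (p::nat)" "\<epsilon> > (0::real)"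
  shows "(\<Prod>p\<in>A. 1 + real p powr (- (1 + \<epsilon>))) \<le> 1 + 1 / \<epsilon>"
proof -
  let ?f = "\<lambda>k::nat. real k powr (- (1 + \<epsilon>))"
  have mult: "?f (\<Prod>B) = (\<Prod>p\<in>B. ?f p)" if "B \<subseteq> A" for B
    by (simp add: prod_powr_distrib)
  have inj: "inj_on (\<lambda>B. \<Prod>B) (Pow A)"
    by (rule inj_on_subset[OF prod_primes_inj_on]) (use assms finite_subset in blast)
  have "(\<Prod>p\<in>A. 1 + ?f p) = (\<Prod>p\<in>A. ?f p + 1)" by (simp add: add.commute)
  also have "\<dots> = (\<Sum>B\<in>Pow A. (\<Prod>p\<in>B. ?f p))"
    by (subst prod_add) (use assms in auto)
  also have "\<dots> = (\<Sum>B\<in>Pow A. ?f (\<Prod>B))"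
    by (intro sum.cong refl) (metis mult PowD)
  also have "\<dots> = (\<Sum>k\<in>Prod ` Pow A. ?f k)"
    by (subst sum.reindex[OF inj]) simp
  also have "\<dots> \<le> (\<Sum>k=1..\<Prod>A. ?f k)"
  proof (intro sum_mono2)
    show "Prod ` Pow A \<subseteq> {1..\<Prod>A}"
    proof safe
      fix B assume B: "B \<subseteq> A"
      have pos: "\<Prod>A > 0" using assms by (intro prod_pos) (auto simp: prime_gt_0_nat)
      have "\<Prod>B dvd \<Prod>A" using B assms by (intro prod_dvd_prod_subset) auto
      then show "\<Prod>B \<in> {1..\<Prod>A}" using pos dvd_imp_le dvd_pos_nat by (auto simp: Suc_le_eq)
    qed
  qed auto
  also have "\<dots> \<le> 1 + 1 / \<epsilon>" by (rule sum_powr_le) fact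
  finally show ?thesis .
qed

lemma prime_factors_ge_2: "p \<in> prime_factors n \<Longrightarrow> p \<ge> (2::nat)"
  using in_prime_factors_imp_prime prime_ge_2_nat by blast

text \<open>The radical of \<open>n\<close> divides \<open>n\<close>; take logarithms.\<close>

lemma sum_prime_factors_ln_le:
  assumes "n > (0::nat)"
  shows "(\<Sum>p\<in>prime_factors n. ln (real p)) \<le> ln (real n)"
proof -
  have "\<Prod>(prime_factors n) dvd (\<Prod>p\<in>prime_factors n. p ^ multiplicity p n)"
    by (intro prod_dvd_prod) (auto simp: prime_factors_multiplicity intro!: dvd_power)
  then have "\<Prod>(prime_factors n) dvd n" using assms prime_factorization_nat by simp
  then have le: "\<Prod>(prime_factors n) \<le> n" using assms dvd_imp_le by blast
  have pos: "\<Prod>(prime_factors n) > 0" by (intro prod_pos) (auto dest: prime_factors_ge_2)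
  have "(\<Sum>p\<in>prime_factors n. ln (real p)) = ln (\<Prod>p\<in>prime_factors n. real p)"
    by (subst ln_prod) (auto dest: prime_factors_ge_2)
  also have "\<dots> = ln (real (\<Prod>(prime_factors n)))" by simp
  also have "\<dots> \<le> ln (real n)"
    using le pos assms by (subst ln_le_cancel_iff) (simp_all del: of_nat_prod)
  finally show ?thesis .
qed

text \<open>Only the correct order of magnitude is needed here, so no Chebyshev estimate:
  counting the prime factors of \<open>1, \<dots>, N\<close> and bounding \<open>\<lfloor>N / p\<rfloor> \<ge> N / (2 p)\<close> is enough.\<close>
lemma sum_ln_prime_over_prime_le:
  assumes "N \<ge> (1::nat)"
  shows "(\<Sum>p | prime p \<and> p \<le> N. ln (real p) / real p) \<le> 2 * ln (real N)"
proof -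
  let ?P = "{p. prime p \<and> p \<le> N}"
  have fin: "finite ?P" by (rule finite_subset[of _ "{..N}"]) auto
  have "real N / 2 * (\<Sum>p\<in>?P. ln (real p) / real p) = (\<Sum>p\<in>?P. (real N / (2 * real p)) * ln (real p))"
    by (simp add: sum_distrib_left field_simps)
  also have "\<dots> \<le> (\<Sum>p\<in>?P. real (N div p) * ln (real p))"
  proof (intro sum_mono mult_right_mono)
    fix p assume p: "p \<in> ?P"
    then have p0: "p > 0" and p1: "N div p \<ge> 1" by (auto simp: prime_gt_0_nat div_greater_zero_iff Suc_le_eq)
    have "N < p * (N div p) + p" using p0 by (metis dividend_less_times_div add.commute mult.commute)
    also have "\<dots> \<le> 2 * (p * (N div p))" using p1 by (cases "N div p") auto
    finally have "real N \<le> real (2 * (p * (N div p)))" by (simp only: of_nat_le_iff)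
    then show "real N / (2 * real p) \<le> real (N div p)" using p0 by (simp add: field_simps)
    show "0 \<le> ln (real p)" using p by (auto dest: prime_ge_1_nat)
  qed
  also have "\<dots> = (\<Sum>p\<in>?P. \<Sum>k | k \<in> {1..N} \<and> p dvd k. ln (real p))"
  proof (intro sum.cong refl)
    fix p assume p: "p \<in> ?P"
    then have p0: "p > 0" by (auto simp: prime_gt_0_nat)
    have "bij_betw (\<lambda>j. p * j) {1..N div p} {k. k \<in> {1..N} \<and> p dvd k}"
      unfolding bij_betw_def
    proof
      show "inj_on (\<lambda>j. p * j) {1..N div p}" using p0 by (auto intro: inj_onI)
      show "(\<lambda>j. p * j) ` {1..N div p} = {k. k \<in> {1..N} \<and> p dvd k}"
      proof (intro equalityI subsetI)
        fix k assume "k \<in> (\<lambda>j. p * j) ` {1..N div p}"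
        then obtain j where "k = p * j" "1 \<le> j" "j \<le> N div p" by (metis imageE atLeastAtMost_iff)
        then show "k \<in> {k. k \<in> {1..N} \<and> p dvd k}"
          using p0 by (simp add: less_eq_div_iff_mult_less_eq mult.commute Suc_le_eq)
      next
        fix k assume "k \<in> {k. k \<in> {1..N} \<and> p dvd k}"
        then obtain j where "k = p * j" "k \<ge> 1" "k \<le> N" by (auto elim: dvdE)
        then show "k \<in> (\<lambda>j. p * j) ` {1..N div p}"
          using p0 by (intro image_eqI[of _ _ j])
            (simp_all add: less_eq_div_iff_mult_less_eq mult.commute Suc_le_eq)
      qed
    qed
    then have "card {1..N div p} = card {k. k \<in> {1..N} \<and> p dvd k}" by (rule bij_betw_same_card)
    then show "real (N div p) * ln (real p) = (\<Sum>k | k \<in> {1..N} \<and> p dvd k. ln (real p))"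
      by simp
  qed
  \<comment> \<open>After exchanging the sums, each k contributes the logarithms of its own prime
    factors, at most ln k in total.\<close>
  also have "\<dots> = (\<Sum>k\<in>{1..N}. \<Sum>p | p \<in> ?P \<and> p dvd k. ln (real p))"
    by (rule sum.swap_restrict) (use fin in auto)
  also have "\<dots> \<le> (\<Sum>k\<in>{1..N}. ln (real N))"
  proof (intro sum_mono)
    fix k assume k: "k \<in> {1..N}"
    have "{p. p \<in> ?P \<and> p dvd k} = prime_factors k"
      using k by (auto simp: prime_factors_dvd dest: dvd_imp_le)
    then have "(\<Sum>p | p \<in> ?P \<and> p dvd k. ln (real p)) \<le> ln (real k)"
      using sum_prime_factors_ln_le[of k] k by simp
    also have "\<dots> \<le> ln (real N)" using k by simp
    finally show "(\<Sum>p | p \<in> ?P \<and> p dvd k. ln (real p)) \<le> ln (real N)" .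
  qed
  also have "\<dots> = real N * ln (real N)" by simp
  finally show ?thesis using assms by (simp add: field_simps)
qed

text \<open>With t = 1/p and a = t * p powr (-\<epsilon>), the loss t - a is at most \<epsilon> * t
  * ln p because exp y \<ge> 1 + y. The second-order errors 2 t^2 and a^2 \<le> t^2 of the two
  logarithms make up the factor 3.\<close>

lemma neg_ln_one_minus_inverse_prime_le:
  assumes "p \<ge> (2::nat)" "\<epsilon> > (0::real)"
  shows "- ln (1 - 1 / real p) \<le>
    ln (1 + real p powr (- (1 + \<epsilon>))) + \<epsilon> * (ln (real p) / real p) + 3 * (1 / (real p)\<^sup>2)"
proof -
  define t where "t = 1 / real p"
  define a where "a = real p powr (- (1 + \<epsilon>))"
  have t: "0 < t" "t \<le> 1/2" using assms by (auto simp: t_def field_simps)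
  have a_eq: "a = t * exp (- \<epsilon> * ln (real p))"
    using assms powr_add[of "real p" "-1" "-\<epsilon>"]
    by (simp add: a_def t_def powr_minus field_simps powr_def exp_minus)
  have "exp (- \<epsilon> * ln (real p)) \<le> 1" using assms by simp
  then have a_le: "a \<le> t" using t by (simp add: a_eq)
  have a0: "a \<ge> 0" by (simp add: a_def)
  have "1 + (- \<epsilon> * ln (real p)) \<le> exp (- \<epsilon> * ln (real p))" by (rule exp_ge_add_one_self)
  then have "t * (1 + (- \<epsilon> * ln (real p))) \<le> a" unfolding a_eq using t by (intro mult_left_mono) auto
  then have t_le: "t \<le> a + \<epsilon> * (ln (real p) * t)" by (simp add: algebra_simps)
  have "- t - 2 * t\<^sup>2 \<le> ln (1 - t)" using t by (intro ln_one_minus_pos_lower_bound) auto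
  moreover have "a - a\<^sup>2 \<le> ln (1 + a)" using a0 a_le t by (intro ln_one_plus_pos_lower_bound) auto
  moreover have "a\<^sup>2 \<le> t\<^sup>2" using a0 a_le by (intro power_mono) auto
  ultimately have "- ln (1 - t) \<le> ln (1 + a) + \<epsilon> * (ln (real p) * t) + 3 * t\<^sup>2" using t_le by linarith
  then show ?thesis by (simp add: t_def a_def power_divide)
qed

lemma prod_primes_le_bound:
  assumes "N \<ge> (3::nat)" "A \<subseteq> {p. prime p \<and> p \<le> N}"
  shows "(\<Prod>p\<in>A. inverse (1 - 1 / real p)) \<le> 2 * exp 5 * ln (real N)"
proof -
  \<comment> \<open>This choice balances the two error sources: 1 + 1/\<epsilon> is at most 2 ln N,
    while the sum of ln p / p, multiplied by \<epsilon>, is at most 2. Together with 3 from the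
    inverse squares this gives the exponent 5.\<close>
  define \<epsilon> where "\<epsilon> = 1 / ln (real N)"
  have "exp 1 \<le> (3::real)" using exp_le by simp
  then have lnN: "ln (real N) \<ge> 1" using assms(1) by (subst ln_ge_iff) auto
  have eps: "\<epsilon> > 0" using lnN by (simp add: \<epsilon>_def)
  have finP: "finite {p. prime p \<and> p \<le> N}" by (rule finite_subset[of _ "{..N}"]) auto
  have fin: "finite A" using finP assms finite_subset by blast
  have prime: "prime p" if "p \<in> A" for p using assms that by auto
  have ge2: "p \<ge> 2" if "p \<in> A" for p using prime[OF that] prime_ge_2_nat by blast
  have pos: "1 - 1 / real p > 0" if "p \<in> A" for p
  proof -
    have "real p \<ge> 2" using ge2[OF that] by simp
    then show ?thesis by (simp add: divide_less_eq)
  qed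

  have gt0: "1 + real p powr t > 0" for p t by (intro add_pos_nonneg) auto
  have "ln (\<Prod>p\<in>A. inverse (1 - 1 / real p)) = (\<Sum>p\<in>A. - ln (1 - 1 / real p))"
    using pos by (subst ln_prod) (auto simp: fin ln_inverse dest: ge2 intro!: sum.cong)
  also have "\<dots> \<le> (\<Sum>p\<in>A. ln (1 + real p powr (- (1 + \<epsilon>))) + \<epsilon> * (ln (real p) / real p) + 3 * (1 / (real p)\<^sup>2))"
    using ge2 eps by (intro sum_mono neg_ln_one_minus_inverse_prime_le) auto
  also have "\<dots> = (\<Sum>p\<in>A. ln (1 + real p powr (- (1 + \<epsilon>)))) + \<epsilon> * (\<Sum>p\<in>A. ln (real p) / real p)
      + 3 * (\<Sum>p\<in>A. 1 / (real p)\<^sup>2)"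
    by (simp add: sum.distrib sum_distrib_left)
  also have "(\<Sum>p\<in>A. ln (1 + real p powr (- (1 + \<epsilon>)))) = ln (\<Prod>p\<in>A. 1 + real p powr (- (1 + \<epsilon>)))"
    using fin gt0 by (subst ln_prod) (auto simp: less_imp_neq[symmetric])
  also have "\<dots> \<le> ln (1 + 1 / \<epsilon>)"
  proof (subst ln_le_cancel_iff)
    show "0 < (\<Prod>p\<in>A. 1 + real p powr (- (1 + \<epsilon>)))" by (intro prod_pos) (auto intro!: add_pos_nonneg)
    show "0 < 1 + 1 / \<epsilon>" using eps by (auto intro!: add_pos_pos)
    show "(\<Prod>p\<in>A. 1 + real p powr (- (1 + \<epsilon>))) \<le> 1 + 1 / \<epsilon>"
      by (rule prod_primes_one_plus_powr_le) (use fin prime eps in auto)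
  qed
  also have "\<dots> \<le> ln (2 * ln (real N))" using lnN by (simp add: \<epsilon>_def)
  also have "\<epsilon> * (\<Sum>p\<in>A. ln (real p) / real p) \<le> \<epsilon> * (2 * ln (real N))"
  proof (intro mult_left_mono)
    have "(\<Sum>p\<in>A. ln (real p) / real p) \<le> (\<Sum>p | prime p \<and> p \<le> N. ln (real p) / real p)"
      using assms finP by (intro sum_mono2) (auto dest: prime_ge_1_nat)
    also have "\<dots> \<le> 2 * ln (real N)" using assms by (intro sum_ln_prime_over_prime_le) auto
    finally show "(\<Sum>p\<in>A. ln (real p) / real p) \<le> 2 * ln (real N)" .
  qed (use eps in auto)
  also have "\<epsilon> * (2 * ln (real N)) = 2" using lnN by (simp add: \<epsilon>_def)
  also have "(\<Sum>p\<in>A. 1 / (real p)\<^sup>2) \<le> 1" using fin ge2 by (rule sum_inverse_squares_le)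
  finally have "ln (\<Prod>p\<in>A. inverse (1 - 1 / real p)) \<le> ln (2 * ln (real N)) + 5" by simp
  moreover have "(\<Prod>p\<in>A. inverse (1 - 1 / real p)) > 0" using pos by (intro prod_pos) auto
  ultimately have "(\<Prod>p\<in>A. inverse (1 - 1 / real p)) \<le> exp (ln (2 * ln (real N)) + 5)"
    by (simp flip: ln_le_cancel_iff)
  also have "\<dots> = 2 * exp 5 * ln (real N)" using lnN by (simp add: exp_add)
  finally show ?thesis .
qed

section \<open>The quotient of \<open>n\<close> by its totient\<close>

definition prime_factor_prod :: "nat \<Rightarrow> real" where
  "prime_factor_prod n = (\<Prod>p\<in>prime_factors n. inverse (1 - 1 / real p))"

text \<open>Euler's product formula: for positive \<open>n\<close>,
  \<open>prime_factor_prod n\<close> is n divided by its totient. This turns a bound for the product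
  into a lower bound for the totient.\<close>

lemma totient_times_prime_factor_prod: "real (totient n) * prime_factor_prod n = real n"
proof -
  have "(1 - 1 / real p) * inverse (1 - 1 / real p) = 1" if "p \<in> prime_factors n" for p
  proof -
    have "real p \<ge> 2" using prime_factors_ge_2[OF that] by simp
    then have "1 - 1 / real p \<noteq> 0" by simp
    then show ?thesis by (rule right_inverse)
  qed
  then show ?thesis
    unfolding totient_formula2 prime_factor_prod_def mult.assoc prod.distrib[symmetric] by simp
qed

text \<open>A crude estimate that takes care of the finitely many \<open>n\<close> below 27.\<close>

lemma prime_factor_prod_le_self:
  assumes "n > 0"
  shows "prime_factor_prod n \<le> real n"
proof -
  have "prime_factor_prod n \<ge> 0" unfolding prime_factor_prod_def
    by (intro prod_nonneg) (auto simp: divide_le_eq dest: prime_factors_ge_2)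
  moreover have "1 \<le> real (totient n)" using assms by (simp add: Suc_le_eq)
  ultimately have "1 * prime_factor_prod n \<le> real (totient n) * prime_factor_prod n"
    by (intro mult_right_mono)
  then show ?thesis by (simp add: totient_times_prime_factor_prod)
qed

lemma inverse_one_minus_inverse_le_exp:
  assumes "p \<ge> (2::nat)"
  shows "inverse (1 - 1 / real p) \<le> exp (2 / real p)"
proof -
  define t where "t = 1 / real p"
  have t: "0 < t" "t \<le> 1/2" using assms by (auto simp: t_def field_simps)
  have "- t - 2 * t\<^sup>2 \<le> ln (1 - t)" using t by (intro ln_one_minus_pos_lower_bound) auto
  moreover have "2 * t\<^sup>2 \<le> t" using t mult_left_mono[of t "1/2" t] by (simp add: power2_eq_square)
  ultimately have "- ln (1 - t) \<le> 2 * t" by linarith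
  then have "exp (- ln (1 - t)) \<le> exp (2 * t)" by simp
  then show ?thesis using t by (simp add: exp_minus t_def)
qed

text \<open>The prime factors are split at L = ln n. Those up to L contribute O(ln L). There are at
  most L larger ones, since their logarithms are at least 1 and add up to at most L; each gives a
  factor of at most exp (2/L), so together at most exp 2. The threshold 27 is 3^3 \<ge> exp 3, which
  makes L \<ge> 3.\<close>

lemma prime_factor_prod_le_ln_ln:
  assumes "n \<ge> 27"
  shows "prime_factor_prod n \<le> 2 * exp 7 * ln (ln (real n))"
proof -
  define L where "L = ln (real n)"
  define N where "N = nat \<lfloor>L\<rfloor>"
  have e: "exp 1 \<le> (3::real)" using exp_le by simp
  have "exp 3 = exp (1::real) ^ 3" by (simp flip: exp_of_nat_mult)
  also have "\<dots> \<le> 3 ^ 3" using e by (intro power_mono) auto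
  also have "\<dots> \<le> real n" using assms by simp
  finally have L3: "L \<ge> 3" using assms by (simp add: L_def ln_ge_iff)
  have N3: "N \<ge> 3" using L3 by (simp add: N_def le_nat_iff le_floor_iff)
  have NL: "real N \<le> L" "L < real N + 1" using L3 by (auto simp: N_def)
  have lnL: "ln L \<ge> 1" using L3 e by (subst ln_ge_iff) auto
  define S where "S = {p \<in> prime_factors n. p \<le> N}"
  define B where "B = {p \<in> prime_factors n. p > N}"
  have fin: "finite S" "finite B" by (auto simp: S_def B_def)
  have B: "p \<ge> 2" "real p \<ge> L" if "p \<in> B" for p
  proof -
    show "p \<ge> 2" using that by (auto simp: B_def dest: prime_factors_ge_2)
    have "real p \<ge> real N + 1" using that by (auto simp: B_def)
    then show "real p \<ge> L" using NL by linarith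
  qed
  have "real (card B) = (\<Sum>p\<in>B. 1)" by simp
  also have "\<dots> \<le> (\<Sum>p\<in>B. ln (real p))"
  proof (intro sum_mono)
    fix p assume "p \<in> B"
    then have "ln L \<le> ln (real p)" using B L3 by (intro ln_mono) auto
    then show "1 \<le> ln (real p)" using lnL by linarith
  qed
  also have "\<dots> \<le> (\<Sum>p\<in>prime_factors n. ln (real p))"
    by (intro sum_mono2) (auto simp: B_def dest: prime_factors_gt_0_nat)
  also have "\<dots> \<le> L" unfolding L_def using assms by (intro sum_prime_factors_ln_le) auto
  finally have cardB: "real (card B) \<le> L" .
  have "(\<Prod>p\<in>B. inverse (1 - 1 / real p)) \<le> (\<Prod>p\<in>B. exp (2 / L))"
  proof (intro prod_mono conjI)
    fix p assume p: "p \<in> B"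
    show "0 \<le> inverse (1 - 1 / real p)" using B[OF p] by (simp add: field_simps)
    have "inverse (1 - 1 / real p) \<le> exp (2 / real p)"
      using B[OF p] by (intro inverse_one_minus_inverse_le_exp)
    also have "\<dots> \<le> exp (2 / L)" using B[OF p] L3 by (auto intro!: divide_left_mono)
    finally show "inverse (1 - 1 / real p) \<le> exp (2 / L)" .
  qed
  also have "\<dots> = exp (real (card B) * (2 / L))" by (simp only: exp_of_nat_mult prod_constant)
  also have "\<dots> \<le> exp 2" using cardB L3 by (simp add: field_simps)
  finally have PB: "(\<Prod>p\<in>B. inverse (1 - 1 / real p)) \<le> exp 2" .
  have "(\<Prod>p\<in>S. inverse (1 - 1 / real p)) \<le> 2 * exp 5 * ln (real N)"
    using N3 by (intro prod_primes_le_bound) (auto simp: S_def)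
  also have "\<dots> \<le> 2 * exp 5 * ln L" using NL N3 by (intro mult_left_mono ln_mono) auto
  finally have PS: "(\<Prod>p\<in>S. inverse (1 - 1 / real p)) \<le> 2 * exp 5 * ln L" .
  have "prime_factors n = S \<union> B" "S \<inter> B = {}" by (auto simp: S_def B_def)
  then have "prime_factor_prod n = (\<Prod>p\<in>S. inverse (1 - 1 / real p)) * (\<Prod>p\<in>B. inverse (1 - 1 / real p))"
    unfolding prime_factor_prod_def using fin by (simp add: prod.union_disjoint)
  also have "\<dots> \<le> (2 * exp 5 * ln L) * exp 2"
  proof (intro mult_mono prod_nonneg ballI)
    fix p assume "p \<in> B"
    then have "real p \<ge> 2" using B(1) by fastforce
    then show "0 \<le> inverse (1 - 1 / real p)" by (simp add: divide_le_eq)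
  qed (use PS PB lnL in auto)
  also have "\<dots> = 2 * exp 7 * ln L"
    using exp_add[of "5::real" 2] by simp
  finally show ?thesis by (simp add: L_def)
qed

lemma prime_factor_prod_bound:
  obtains C where "C > 0" "\<And>n. n \<ge> 3 \<Longrightarrow> prime_factor_prod n \<le> C * ln (ln (real n))"
proof -
  \<comment> \<open>The strict inequality e < 3 makes ln (ln 3) positive. It follows from 1/3 <
    (5/6)^6 \<le> 1/e.\<close>
  have "(1 + (-1/6)) ^ 6 \<le> exp (-1/6 :: real) ^ 6"
    by (intro power_mono exp_ge_add_one_self) auto
  also have "\<dots> = exp (-1)" by (simp flip: exp_of_nat_mult)
  finally have "exp 1 < (3::real)" by (simp add: exp_minus field_simps)
  then have "ln 3 > (1::real)" by (metis exp_ln_iff ln_exp ln_less_cancel_iff exp_gt_zero zero_less_numeral)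
  then have pos: "ln (ln 3) > (0::real)" by simp
  \<comment> \<open>The second entry of the maximum covers 3 \<le> n < 27, where the product is at
    most 27 and ln (ln n) at least ln (ln 3).\<close>
  define C :: real where "C = max (2 * exp 7) (27 / ln (ln 3))"
  have "C > 0" by (auto simp: C_def less_max_iff_disj)
  have mono: "ln (ln 3) \<le> ln (ln (real n))" if "n \<ge> 3" for n
    using that \<open>ln 3 > 1\<close> by (intro ln_mono) auto
  show ?thesis
  proof
    show "C > 0" by fact
    fix n :: nat assume n: "n \<ge> 3"
    show "prime_factor_prod n \<le> C * ln (ln (real n))"
    proof (cases "n \<ge> 27")
      case True
      then have "prime_factor_prod n \<le> 2 * exp 7 * ln (ln (real n))" by (rule prime_factor_prod_le_ln_ln)
      also have "\<dots> \<le> C * ln (ln (real n))"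
        using mono[OF n] less_imp_le[OF pos]
        by (intro mult_right_mono) (simp_all add: C_def del: ln_ge_zero_iff)
      finally show ?thesis .
    next
      case False
      have "prime_factor_prod n \<le> 27" using prime_factor_prod_le_self[of n] n False by simp
      also have "\<dots> = 27 / ln (ln 3) * ln (ln 3)" using pos by simp
      also have "\<dots> \<le> C * ln (ln (real n))"
        using mono[OF n] less_imp_le[OF pos] \<open>C > 0\<close>
        by (intro mult_mono) (simp_all add: C_def)
      finally show ?thesis .
    qed
  qed
qed

text \<open>Splitting off a full prime power p^k, every divisor of n is p^i * d with i \<le> k and d
  dividing the cofactor m. The sum over i is a truncated geometric series, bounded by the Euler
  factor of p.\<close>

lemma sum_inverse_divisors_le_prime_factor_prod:
  assumes "n > 0"
  shows "(\<Sum>d | d dvd n. 1 / real d) \<le> prime_factor_prod n"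
  using assms
proof (induction n rule: less_induct)
  case (less n)
  show ?case
  proof (cases "n = 1")
    case True
    then show ?thesis by (simp add: prime_factor_prod_def)
  next
    case False
    then obtain p where p: "prime p" "p dvd n" using prime_factor_nat by blast
    define k where "k = multiplicity p n"
    define m where "m = n div p ^ k"
    have k0: "k > 0" using p less.prems by (simp add: k_def prime_multiplicity_gt_zero_iff)
    have n: "n = p ^ k * m" by (simp add: m_def k_def multiplicity_dvd)
    have pm: "\<not> p dvd m"
      using multiplicity_decompose[of n p] p less.prems by (auto simp: m_def k_def dest: prime_gt_1_nat)
    have m0: "m > 0" using n less.prems by (cases m) auto
    have p2: "p \<ge> 2" using p prime_ge_2_nat by blast
    have mn: "m < n" using n k0 m0 p2 one_less_power[of p k] by auto
    have pf: "prime_factors n = insert p (prime_factors m)"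
      using m0 p2 k0 p unfolding n
      by (subst prime_factors_product) (auto simp: prime_factors_power prime_prime_factors)
    have prod: "prime_factor_prod n = inverse (1 - 1 / real p) * prime_factor_prod m"
      unfolding prime_factor_prod_def pf using pm by (subst prod.insert) auto
    define g where "g = (\<lambda>(i, d). p ^ i * d :: nat)"
    have sub: "{d. d dvd n} \<subseteq> g ` ({..k} \<times> {d. d dvd m})"
    proof
      fix d assume "d \<in> {d. d dvd n}"
      then obtain a b where ab: "d = a * b" "a dvd p ^ k" "b dvd m"
        unfolding n by (auto elim: dvd_productE)
      then obtain i where "i \<le> k" "a = p ^ i" using divides_primepow_nat[OF p(1)] by auto
      then show "d \<in> g ` ({..k} \<times> {d. d dvd m})" using ab by (auto simp: g_def image_iff)
    qed
    have "(\<Sum>d | d dvd n. 1 / real d) \<le> (\<Sum>d\<in>g ` ({..k} \<times> {d. d dvd m}). 1 / real d)"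
      using sub m0 by (intro sum_mono2) auto
    also have "\<dots> \<le> (\<Sum>x\<in>{..k} \<times> {d. d dvd m}. ((\<lambda>d. 1 / real d) \<circ> g) x)"
      using m0 by (intro sum_image_le) auto
    also have "\<dots> = (\<Sum>i\<le>k. (1 / real p) ^ i) * (\<Sum>d | d dvd m. 1 / real d)"
      by (simp add: sum_product sum.cartesian_product g_def case_prod_unfold power_divide)
    also have "\<dots> \<le> inverse (1 - 1 / real p) * prime_factor_prod m"
    proof (intro mult_mono)
      show "(\<Sum>d | d dvd m. 1 / real d) \<le> prime_factor_prod m" using less.IH mn m0 by simp
      have "1 - (1 / real p) ^ Suc k = (1 - 1 / real p) * (\<Sum>i\<le>k. (1 / real p) ^ i)"
        by (simp only: one_diff_power_eq lessThan_Suc_atMost)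
      moreover have "1 - 1 / real p > 0" using p2 by (simp add: field_simps)
      ultimately show "(\<Sum>i\<le>k. (1 / real p) ^ i) \<le> inverse (1 - 1 / real p)"
        by (simp add: field_simps)
      show "0 \<le> inverse (1 - 1 / real p)" using p2 by (simp add: field_simps)
    qed (auto intro: sum_nonneg)
    finally show ?thesis using prod by simp
  qed
qed

section \<open>Root quadruples as reduced quadratic forms\<close>

text \<open>The triple encodes the form [x, 2m, y] of discriminant -4 n^2. Taking m nonnegative
  selects one form out of each pair with opposite middle coefficients.\<close>

definition reduced_forms :: "int \<Rightarrow> (int \<times> int \<times> int) set" where
  "reduced_forms n = {(x, m, y). 0 \<le> m \<and> 2 * m \<le> x \<and> x \<le> y \<and> x * y = n\<^sup>2 + m\<^sup>2 \<and>
     (\<forall>d. d dvd x \<longrightarrow> d dvd y \<longrightarrow> d dvd m \<longrightarrow> d dvd n \<longrightarrow> is_unit d)}"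

lemma Gcd_quadruple_eq_1_iff:
  "Gcd {a, b, c, d :: int} = 1 \<longleftrightarrow>
     (\<forall>e. e dvd a \<longrightarrow> e dvd b \<longrightarrow> e dvd c \<longrightarrow> e dvd d \<longrightarrow> is_unit e)"
proof
  assume *: "Gcd {a, b, c, d} = 1"
  show "\<forall>e. e dvd a \<longrightarrow> e dvd b \<longrightarrow> e dvd c \<longrightarrow> e dvd d \<longrightarrow> is_unit e"
  proof (intro allI impI)
    fix e assume "e dvd a" "e dvd b" "e dvd c" "e dvd d"
    then have "e dvd Gcd {a, b, c, d}" by (intro Gcd_greatest) auto
    then show "is_unit e" by (simp only: *)
  qed
next
  assume *: "\<forall>e. e dvd a \<longrightarrow> e dvd b \<longrightarrow> e dvd c \<longrightarrow> e dvd d \<longrightarrow> is_unit e"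
  have "is_unit (Gcd {a, b, c, d})"
    by (rule *[rule_format]; rule Gcd_dvd) auto
  then show "Gcd {a, b, c, d} = 1" by (metis is_unit_normalize normalize_Gcd)
qed

text \<open>In terms of \<open>x = a + b\<close>, \<open>y = a + c\<close>, \<open>z = a + d\<close>, the equation forces \<open>x + y - z\<close> to be even,
  and \<open>m\<close> is half of it.\<close>
lemma root_quadruple_iff_reduced_form:
  assumes "n > 0"
  shows "root_quadruple (- n, x + n, y + n, x + y - 2 * m + n) \<and>
      primitive_quadruple (- n, x + n, y + n, x + y - 2 * m + n) \<longleftrightarrow> (x, m, y) \<in> reduced_forms n"
proof -
  have eq: "descartes_quadruple (- n, x + n, y + n, x + y - 2 * m + n) \<longleftrightarrow> x * y = n\<^sup>2 + m\<^sup>2"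
    unfolding descartes_quadruple_def by (auto simp: power2_eq_square algebra_simps)
  have prim: "primitive_quadruple (- n, x + n, y + n, x + y - 2 * m + n) \<longleftrightarrow>
      (\<forall>d. d dvd x \<longrightarrow> d dvd y \<longrightarrow> d dvd m \<longrightarrow> d dvd n \<longrightarrow> is_unit d)"
    (is "?P \<longleftrightarrow> ?Q") if xy: "x * y = n\<^sup>2 + m\<^sup>2"
  proof -
    have P: "?P \<longleftrightarrow> (\<forall>d. d dvd x \<longrightarrow> d dvd y \<longrightarrow> d dvd 2 * m \<longrightarrow> d dvd n \<longrightarrow> is_unit d)"
    proof -
      have "d dvd - n \<and> d dvd x + n \<and> d dvd y + n \<and> d dvd x + y - 2 * m + n \<longleftrightarrow>
          d dvd x \<and> d dvd y \<and> d dvd 2 * m \<and> d dvd n" for d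
      proof (cases "d dvd n")
        case True
        then have "d dvd x + n \<longleftrightarrow> d dvd x" "d dvd y + n \<longleftrightarrow> d dvd y"
          "d dvd x + y - 2 * m + n \<longleftrightarrow> d dvd x + y - 2 * m"
          by (simp_all add: dvd_add_left_iff)
        then show ?thesis using True
          by (auto simp: dvd_diff_right_iff dvd_diff_left_iff)
      qed auto
      then show ?thesis unfolding primitive_quadruple_def prod.case Gcd_quadruple_eq_1_iff
        by blast
    qed
    show ?thesis
    proof
      assume ?P
      then show ?Q using P by auto
    next
      assume Q: ?Q
      show ?P unfolding P
      proof (intro allI impI)
        fix d assume d: "d dvd x" "d dvd y" "d dvd 2 * m" "d dvd n"
        show "is_unit d"
        proof (cases "even d")
          case False
          then have "coprime d 2" by simp
          then have "d dvd m" using d(3) by (simp add: coprime_dvd_mult_right_iff)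
          then show ?thesis using Q d by blast
        next
          \<comment> \<open>The quadruple only sees 2m, so an even common divisor needs care: x, y
            and n are then even, the equation makes m even as well, and 2 would divide
            everything.\<close>
          case True
          then have ev: "even x" "even y" "even n" using d by (auto intro: dvd_trans)
          then have "even (n\<^sup>2 + m\<^sup>2)" using xy by (metis even_mult_iff)
          then have "even m" using ev by simp
          then have "is_unit (2::int)" using Q ev by blast
          then show ?thesis by simp
        qed
      qed
    qed
  qed
  show ?thesis
  proof
    assume "root_quadruple (- n, x + n, y + n, x + y - 2 * m + n) \<and>
      primitive_quadruple (- n, x + n, y + n, x + y - 2 * m + n)"
    then show "(x, m, y) \<in> reduced_forms n"
      using eq prim unfolding root_quadruple_def reduced_forms_def by auto
  next
    assume R: "(x, m, y) \<in> reduced_forms n"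
    then have "x * y = n\<^sup>2 + m\<^sup>2" "0 \<le> m" "2 * m \<le> x" "x \<le> y" by (auto simp: reduced_forms_def)
    then show "root_quadruple (- n, x + n, y + n, x + y - 2 * m + n) \<and>
      primitive_quadruple (- n, x + n, y + n, x + y - 2 * m + n)"
      using eq prim R assms unfolding root_quadruple_def reduced_forms_def by auto
  qed
qed

lemma N_root_star_eq_card_reduced_forms:
  assumes "n > 0"
  shows "N_root_star (- n) = card (reduced_forms n)"
proof -
  define f where "f = (\<lambda>(x, m, y). (- n, x + n, y + n, x + y - 2 * m + n) :: int \<times> int \<times> int \<times> int)"
  have "f ` reduced_forms n = {(a, b, c, d). root_quadruple (a, b, c, d) \<and> primitive_quadruple (a, b, c, d) \<and> a = - n}"
    (is "_ = ?Q")
  proof (intro equalityI subsetI)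
    fix q assume "q \<in> f ` reduced_forms n"
    then show "q \<in> ?Q" using root_quadruple_iff_reduced_form[OF assms] by (auto simp: f_def)
  next
    fix q assume "q \<in> ?Q"
    then obtain b c d where q: "q = (- n, b, c, d)" "root_quadruple (- n, b, c, d)"
      "primitive_quadruple (- n, b, c, d)" by auto
    \<comment> \<open>Completing the square shows that the candidate for 2m has a square divisible
      by 4, so m is an integer.\<close>
    have "(b + c - n - d)\<^sup>2 = 4 * ((b - n) * (c - n) - n\<^sup>2)"
      using q(2) unfolding root_quadruple_def descartes_quadruple_def
      by (auto simp: power2_eq_square algebra_simps)
    then have "even ((b + c - n - d)\<^sup>2)" by simp
    then have "even (b + c - n - d)" by simp
    then obtain m where m: "b + c - n - d = 2 * m" by (rule evenE)
    have "q = f (b - n, m, c - n)" using q m by (simp add: f_def)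
    moreover have "(b - n, m, c - n) \<in> reduced_forms n"
      using root_quadruple_iff_reduced_form[OF assms, of "b - n" "c - n" m] q m
      by (simp add: algebra_simps)
    ultimately show "q \<in> f ` reduced_forms n" by blast
  qed
  moreover have "inj_on f (reduced_forms n)" by (auto simp: f_def inj_on_def)
  ultimately show ?thesis unfolding N_root_star_def by (metis card_image)
qed

section \<open>Gram matrices of integer vectors and the upper bound\<close>

lemma exists_centered_residue:
  assumes "x > (0::int)"
  obtains k where "2 * \<bar>m + k * x\<bar> \<le> x"
proof
  \<comment> \<open>This is m/x rounded to a nearest integer.\<close>
  define q where "q = (2 * m + x) div (2 * x)"
  have "(2 * m + x) = q * (2 * x) + (2 * m + x) mod (2 * x)"
    unfolding q_def by (rule div_mult_mod_eq[symmetric])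
  moreover have "0 \<le> (2 * m + x) mod (2 * x)" "(2 * m + x) mod (2 * x) < 2 * x" using assms by auto
  ultimately show "2 * \<bar>m + (- q) * x\<bar> \<le> x" by (auto simp: abs_if algebra_simps)
qed

text \<open>Descent: shifting \<open>(r, s)\<close> by multiples of \<open>(p, q)\<close> and of \<open>(- q, p)\<close> moves \<open>m\<close> and \<open>n\<close>
  independently by multiples of \<open>x\<close>; once \<open>\<bar>m\<bar>, \<bar>n\<bar> \<le> x / 2\<close>, we have \<open>y < x\<close> and the two
  vectors can be exchanged.\<close>
lemma gram_matrix_of_integer_vectors:
  fixes x y m n :: int
  assumes "x > 0" "y \<ge> 0" "x * y = m\<^sup>2 + n\<^sup>2"
    "\<And>d. d dvd x \<Longrightarrow> d dvd y \<Longrightarrow> d dvd m \<Longrightarrow> d dvd n \<Longrightarrow> is_unit d"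
  shows "\<exists>p q r s. x = p\<^sup>2 + q\<^sup>2 \<and> y = r\<^sup>2 + s\<^sup>2 \<and> m = p * r + q * s \<and> n = p * s - q * r"
  using assms
proof (induction "nat x" arbitrary: x y m n rule: less_induct)
  case less
  obtain k where k: "2 * \<bar>m + k * x\<bar> \<le> x" using exists_centered_residue less.prems by metis
  obtain l where l: "2 * \<bar>n + l * x\<bar> \<le> x" using exists_centered_residue less.prems by metis
  \<comment> \<open>\<open>y'\<close> is the squared length of the shifted second vector, so that
    the determinant equation persists.\<close>
  define m' n' y' where "m' = m + k * x" "n' = n + l * x"
    and "y' = y + 2 * k * m + 2 * l * n + (k\<^sup>2 + l\<^sup>2) * x"
  note defs = this
  have eq: "x * y' = m'\<^sup>2 + n'\<^sup>2"
    using less.prems(3) unfolding defs by (simp add: power2_eq_square algebra_simps)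
  have y'0: "y' \<ge> 0" using eq less.prems(1) by (metis sum_power2_ge_zero zero_le_mult_iff not_less)
  have prim: "is_unit d" if d: "d dvd x" "d dvd y'" "d dvd m'" "d dvd n'" for d
  proof -
    have "m = m' - k * x" "n = n' - l * x" by (auto simp: defs)
    then have m: "d dvd m" and n: "d dvd n" using d by auto
    have "y = y' - 2 * k * m - 2 * l * n - (k\<^sup>2 + l\<^sup>2) * x" by (auto simp: defs)
    then have "d dvd y" using d m n by auto
    then show ?thesis using less.prems(4) d m n by blast
  qed
  have "\<exists>p q r s. x = p\<^sup>2 + q\<^sup>2 \<and> y' = r\<^sup>2 + s\<^sup>2 \<and> m' = p * r + q * s \<and> n' = p * s - q * r"
  proof (cases "y' = 0")
    case True
    \<comment> \<open>The descent ends here: x divides all four numbers, so primitivity gives x = 1,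
      and the vectors (1, 0) and (0, 0) work.\<close>
    then have "m' = 0" "n' = 0" using eq by (auto simp: sum_power2_eq_zero_iff)
    then have "is_unit x" using prim[of x] True by simp
    then have "x = 1" using less.prems(1) by simp
    then show ?thesis using True \<open>m' = 0\<close> \<open>n' = 0\<close>
      by (intro exI[of _ 1] exI[of _ 0]) auto
  next
    case False
    have "4 * m'\<^sup>2 \<le> x\<^sup>2" "4 * n'\<^sup>2 \<le> x\<^sup>2"
      using power_mono[OF k, of 2] power_mono[OF l, of 2] by (auto simp: defs power_mult_distrib)
    then have "4 * (x * y') \<le> 2 * (x * x)" using eq by (simp add: power2_eq_square)
    then have "x * (4 * y') \<le> x * (2 * x)" by (simp add: algebra_simps)
    then have "4 * y' \<le> 2 * x" using less.prems(1) mult_le_cancel_left_pos by blast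
    then have "nat y' < nat x" using less.prems(1) y'0 by linarith
    moreover have "y' > 0" using False y'0 by simp
    \<comment> \<open>Exchanging the two vectors reverses the orientation, hence the sign of
      \<open>n'\<close>.\<close>
    moreover have "y' * x = m'\<^sup>2 + (- n')\<^sup>2" using eq by (simp add: mult.commute)
    ultimately obtain p q r s where
      "y' = p\<^sup>2 + q\<^sup>2" "x = r\<^sup>2 + s\<^sup>2" "m' = p * r + q * s" "- n' = p * s - q * r"
      using less.hyps[of y' x m' "- n'"] less.prems(1) prim by auto
    then show ?thesis
      by (intro exI[of _ r] exI[of _ s] exI[of _ p] exI[of _ q]) (auto simp: algebra_simps)
  qed
  then obtain p q r s where *: "x = p\<^sup>2 + q\<^sup>2" "y' = r\<^sup>2 + s\<^sup>2" "m' = p * r + q * s" "n' = p * s - q * r"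
    by blast
  \<comment> \<open>The shifts by (p, q) and (- q, p) are undone on the second vector.\<close>
  define R S where RS: "R = r - k * p + l * q" "S = s - k * q - l * p"
  have m: "m = p * R + q * S" and n: "n = p * S - q * R"
    using * unfolding defs RS by (auto simp: power2_eq_square algebra_simps)
  have "x * y = (p * R + q * S)\<^sup>2 + (p * S - q * R)\<^sup>2" using less.prems(3) m n by simp
  also have "\<dots> = x * (R\<^sup>2 + S\<^sup>2)"
    unfolding *(1) by (simp add: power2_eq_square algebra_simps)
  finally have "x * y = x * (R\<^sup>2 + S\<^sup>2)" .
  then have "y = R\<^sup>2 + S\<^sup>2" using less.prems(1) by simp
  then show ?case using *(1) m n by blast
qed

text \<open>From x^2 \<le> x y = n^2 + m^2 and 4 m^2 \<le> x^2 follows 3 x^2 \<le> 4 n^2. As y is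
  determined by x and m, counting forms amounts to counting pairs (x, m).\<close>

lemma reduced_form_bounds:
  assumes "(x, m, y) \<in> reduced_forms n" "n > 0"
  shows "0 < x" "x \<le> 2 * n" "0 \<le> m" "m < x" "y = (n\<^sup>2 + m\<^sup>2) div x"
proof -
  have R: "x * y = n\<^sup>2 + m\<^sup>2" "0 \<le> m" "2 * m \<le> x" "x \<le> y"
    using assms by (auto simp: reduced_forms_def)
  have "n\<^sup>2 + m\<^sup>2 > 0" using assms by (simp add: add_pos_nonneg)
  then have "x \<noteq> 0" using R by auto
  then show x: "0 < x" using R by linarith
  then show "0 \<le> m" "m < x" "y = (n\<^sup>2 + m\<^sup>2) div x" using R by (auto simp flip: R(1))
  have "4 * m\<^sup>2 \<le> x\<^sup>2" using power_mono[OF R(3), of 2] R by (simp add: power_mult_distrib)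
  moreover have "x\<^sup>2 \<le> x * y" unfolding power2_eq_square using R x by (intro mult_left_mono) auto
  moreover have "(2 * n)\<^sup>2 = 4 * n\<^sup>2" by (simp add: power_mult_distrib)
  ultimately have "x\<^sup>2 \<le> (2 * n)\<^sup>2" using R(1) zero_le_power2[of n] by linarith
  then show "x \<le> 2 * n" by (rule power2_le_imp_le) (use assms(2) in simp)
qed

text \<open>Two solutions (r, s) of p s - q r = n differ by a multiple of (p, q)/g with g = gcd p q.
  Hence m is fixed modulo e = (p^2 + q^2)/g, and an interval of length g e contains at most g such
  values.\<close>

lemma card_second_vectors_le:
  fixes p q n :: int
  assumes "p\<^sup>2 + q\<^sup>2 > 0"
  defines "M \<equiv> {m. 0 \<le> m \<and> m < p\<^sup>2 + q\<^sup>2 \<and> (\<exists>r s. m = p * r + q * s \<and> n = p * s - q * r)}"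
  shows "finite M" "card M \<le> nat (gcd p q)"
proof -
  define g where "g = gcd p q"
  define e where "e = (p\<^sup>2 + q\<^sup>2) div g"
  have g0: "g > 0" using assms by (auto simp: g_def)
  have "g dvd p\<^sup>2 + q\<^sup>2" by (auto simp: g_def power2_eq_square)
  then have x: "p\<^sup>2 + q\<^sup>2 = g * e" by (simp add: e_def)
  then have e0: "e > 0" using assms g0 by (metis zero_less_mult_pos)
  show "finite M" by (rule finite_subset[of _ "{0..<p\<^sup>2 + q\<^sup>2}"]) (auto simp: M_def)
  have cong: "e dvd m - m'" if "m \<in> M" "m' \<in> M" for m m'
  proof -
    obtain r s r' s' where rs: "m = p * r + q * s" "n = p * s - q * r" "m' = p * r' + q * s'" "n = p * s' - q * r'"
    proof -
      obtain r s where "m = p * r + q * s" "n = p * s - q * r"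
        using \<open>m \<in> M\<close> unfolding M_def by blast
      moreover obtain r' s' where "m' = p * r' + q * s'" "n = p * s' - q * r'"
        using \<open>m' \<in> M\<close> unfolding M_def by blast
      ultimately show ?thesis using that by blast
    qed
    obtain u v where uv: "g = u * p + v * q" using bezout_int[of p q] unfolding g_def by metis
    \<comment> \<open>The difference of the solutions is k/g times (p, q); Bezout's identity yields
      k as an integer.\<close>
    define k where "k = u * (r - r') + v * (s - s')"
    have d: "p * (s - s') = q * (r - r')" using rs by (simp add: algebra_simps)
    have "g * (r - r') = u * p * (r - r') + v * (q * (r - r'))"
      unfolding uv by (simp add: algebra_simps)
    also have "\<dots> = k * p"
      unfolding d[symmetric] k_def by (simp add: algebra_simps)
    finally have "g * (r - r') = k * p" .
    moreover have "g * (s - s') = u * (p * (s - s')) + v * q * (s - s')"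
      unfolding uv by (simp add: algebra_simps)
    then have "g * (s - s') = k * q"
      unfolding d k_def by (simp add: algebra_simps)
    moreover have "g * (m - m') = p * (g * (r - r')) + q * (g * (s - s'))"
      unfolding rs by (simp add: algebra_simps)
    ultimately have "g * (m - m') = k * (p\<^sup>2 + q\<^sup>2)"
      by (simp add: power2_eq_square algebra_simps)
    then have "g * (m - m') = g * (k * e)" using x by simp
    then have "m - m' = k * e" using g0 by simp
    then show ?thesis by simp
  qed
  have "inj_on (\<lambda>m. m div e) M"
  proof (rule inj_onI)
    fix m m' assume "m \<in> M" "m' \<in> M" and div: "m div e = m' div e"
    then have "m mod e = m' mod e" using cong by (simp add: mod_eq_dvd_iff)
    then show "m = m'" using div by (metis div_mult_mod_eq)
  qed
  moreover have "(\<lambda>m. m div e) ` M \<subseteq> {0..<g}"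
  proof
    fix j assume "j \<in> (\<lambda>m. m div e) ` M"
    then obtain m where m: "j = m div e" "0 \<le> m" "m < g * e" unfolding M_def x by blast
    have "m div e * e \<le> m" using div_mult_mod_eq[of m e] pos_mod_sign[OF e0, of m] by linarith
    then have "j * e \<le> m" by (simp add: m(1))
    then have "j * e < g * e" using m(3) by linarith
    then show "j \<in> {0..<g}" using e0 m by (simp add: pos_imp_zdiv_nonneg_iff)
  qed
  ultimately have "card M \<le> card {0..<g}" using card_inj_on_le by blast
  then show "card M \<le> nat (gcd p q)" by (simp add: g_def)
qed

text \<open>Dividing by g places the points in the square of integer points with coordinates at most
  K in absolute value, where K is about sqrt X / g.\<close>

lemma card_lattice_points_disc_le:
  fixes g :: int and X :: int
  assumes "g > 0" "X > 0"
  defines "D \<equiv> {(p, q). 0 < p\<^sup>2 + q\<^sup>2 \<and> p\<^sup>2 + q\<^sup>2 \<le> X \<and> g dvd p \<and> g dvd q}"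
  shows "finite D" "real (card D) \<le> 9 * real_of_int X / (real_of_int g)\<^sup>2"
proof -
  define K where "K = \<lfloor>sqrt (real_of_int X) / real_of_int g\<rfloor>"
  have K_ge: "\<bar>u\<bar> \<le> K" if "(g * u)\<^sup>2 \<le> X" for u :: int
  proof -
    have "real_of_int ((g * u)\<^sup>2) \<le> real_of_int X" using that by (simp only: of_int_le_iff)
    then have "sqrt ((real_of_int (g * u))\<^sup>2) \<le> sqrt (real_of_int X)" by (intro real_sqrt_le_mono) simp
    then have "real_of_int g * \<bar>real_of_int u\<bar> \<le> sqrt (real_of_int X)" using assms by (simp add: abs_mult)
    then show ?thesis using assms by (simp add: K_def le_floor_iff field_simps)
  qed
  have sub: "D \<subseteq> (\<lambda>(u, v). (g * u, g * v)) ` ({- K..K} \<times> {- K..K})"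
  proof
    fix w assume "w \<in> D"
    then obtain u v where w: "w = (g * u, g * v)" "(g * u)\<^sup>2 + (g * v)\<^sup>2 \<le> X"
      by (auto simp: D_def elim!: dvdE)
    have "0 \<le> (g * u)\<^sup>2" "0 \<le> (g * v)\<^sup>2" by auto
    then have "(g * u)\<^sup>2 \<le> X" "(g * v)\<^sup>2 \<le> X" using w(2) by linarith+
    then have "\<bar>u\<bar> \<le> K" "\<bar>v\<bar> \<le> K" using K_ge by auto
    then show "w \<in> (\<lambda>(u, v). (g * u, g * v)) ` ({- K..K} \<times> {- K..K})"
      using w by (intro image_eqI[of _ _ "(u, v)"]) auto
  qed
  then show "finite D" by (rule finite_subset) auto
  show "real (card D) \<le> 9 * real_of_int X / (real_of_int g)\<^sup>2"
  proof (cases "D = {}")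
    \<comment> \<open>A nonzero lattice point forces K \<ge> 1, so 2K + 1 \<le> 3K; this is the
      source of the constant 9.\<close>
    case False
    then obtain u v where uv: "0 < (g * u)\<^sup>2 + (g * v)\<^sup>2" "(g * u)\<^sup>2 + (g * v)\<^sup>2 \<le> X"
      by (auto simp: D_def elim!: dvdE)
    have "0 \<le> (g * u)\<^sup>2" "0 \<le> (g * v)\<^sup>2" by auto
    then have "(g * u)\<^sup>2 \<le> X" "(g * v)\<^sup>2 \<le> X" using uv by linarith+
    then have "\<bar>u\<bar> \<le> K" "\<bar>v\<bar> \<le> K" using K_ge by auto
    moreover have "u \<noteq> 0 \<or> v \<noteq> 0" using uv by auto
    ultimately have K1: "K \<ge> 1" by linarith
    have "card D \<le> card ({- K..K} \<times> {- K..K})" using sub by (rule surj_card_le[rotated]) auto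
    also have "\<dots> = nat (2 * K + 1) * nat (2 * K + 1)" by (simp add: card_cartesian_product)
    also have "real \<dots> = (2 * real_of_int K + 1)\<^sup>2" using K1 by (simp add: power2_eq_square)
    also have "\<dots> \<le> (3 * real_of_int K)\<^sup>2" using K1 by (intro power_mono) auto
    also have "\<dots> \<le> (3 * (sqrt (real_of_int X) / real_of_int g))\<^sup>2"
      using K1 by (intro power_mono mult_left_mono) (auto simp: K_def)
    also have "\<dots> = 9 * real_of_int X / (real_of_int g)\<^sup>2"
      using assms by (simp add: power_mult_distrib power_divide)
    finally show ?thesis by simp
  next
    case True
    then show ?thesis using assms(1,2) by simp
  qed
qed

text \<open>A vector \<open>(p, q)\<close> with \<open>gcd p q = g\<close> occurs in at most \<open>g\<close> reduced forms, and \<open>g\<close> divides \<open>n\<close>.\<close>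
lemma card_reduced_forms_le:
  assumes "n > (0::nat)"
  shows "finite (reduced_forms (int n))"
    "real (card (reduced_forms (int n))) \<le> 18 * real n * (\<Sum>g | g dvd n. 1 / real g)"
proof -
  define M where "M = (\<lambda>(p, q). {m. 0 \<le> m \<and> m < p\<^sup>2 + q\<^sup>2 \<and>
    (\<exists>r s. m = p * r + q * s \<and> int n = p * s - q * r)})"
  \<comment> \<open>\<open>D g\<close> relaxes the condition gcd p q = g of \<open>E g\<close> to
    divisibility by g, for which the disc estimate applies.\<close>
  define D where "D = (\<lambda>g::nat. {(p, q). 0 < p\<^sup>2 + q\<^sup>2 \<and> p\<^sup>2 + q\<^sup>2 \<le> 2 * int n \<and> int g dvd p \<and> int g dvd q})"
  define E where "E = (\<lambda>g::nat. {(p, q) \<in> D g. gcd p q = int g})"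
  define W where "W = (\<Union>g\<in>{g. g dvd n}. Sigma (E g) M)"
  define F where "F = (\<lambda>((p, q), m). (p\<^sup>2 + q\<^sup>2, m, ((int n)\<^sup>2 + m\<^sup>2) div (p\<^sup>2 + q\<^sup>2)) :: int \<times> int \<times> int)"
  have fin_div: "finite {g. g dvd n}" using assms by simp
  have dpos: "g > 0" if "g dvd n" for g using that assms by (rule dvd_pos_nat[rotated])
  have D: "finite (D g)" "real (card (D g)) \<le> 18 * real n / (real g)\<^sup>2" if "g > 0" for g
    using card_lattice_points_disc_le[of "int g" "2 * int n"] that assms by (auto simp: D_def)
  have E_sub: "E g \<subseteq> D g" for g by (auto simp: E_def)
  have fin_E: "finite (E g)" if "g dvd n" for g
    using D(1)[OF dpos[OF that]] E_sub by (rule finite_subset[rotated])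
  have M: "finite (M w)" "card (M w) \<le> g" if "w \<in> E g" for w g
    using that card_second_vectors_le[of "fst w" "snd w" "int n"]
    by (auto simp: E_def D_def M_def case_prod_unfold)
  have finW: "finite W" unfolding W_def using fin_div fin_E M(1) by (intro finite_UN_I finite_SigmaI) auto
  have sub: "reduced_forms (int n) \<subseteq> F ` W"
  proof
    fix f assume f: "f \<in> reduced_forms (int n)"
    obtain x m y where xmy: "f = (x, m, y)" by (metis prod_cases3)
    note R = f[unfolded xmy]
    note b = reduced_form_bounds[OF R]
    have y: "x * y = m\<^sup>2 + (int n)\<^sup>2" "y \<ge> 0"
      and prim: "\<And>d. d dvd x \<Longrightarrow> d dvd y \<Longrightarrow> d dvd m \<Longrightarrow> d dvd int n \<Longrightarrow> is_unit d"
      using R b(1) assms unfolding reduced_forms_def by auto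
    obtain p q r s where pqrs: "x = p\<^sup>2 + q\<^sup>2" "m = p * r + q * s" "int n = p * s - q * r"
      using gram_matrix_of_integer_vectors[OF _ y(2,1) prim] b(1) assms by auto
    define g where "g = nat (gcd p q)"
    have g: "int g = gcd p q" by (simp add: g_def)
    have "int g dvd int n" unfolding g pqrs(3) by auto
    then have "g dvd n" by simp
    moreover have "(p, q) \<in> E g" using b assms by (auto simp: E_def D_def g pqrs(1)[symmetric])
    moreover have "m \<in> M (p, q)" using b assms pqrs by (auto simp: M_def)
    ultimately have "((p, q), m) \<in> W" by (auto simp: W_def)
    moreover have "f = F ((p, q), m)" using b assms by (simp add: F_def xmy flip: pqrs(1))
    ultimately show "f \<in> F ` W" by blast
  qed
  then show "finite (reduced_forms (int n))" by (rule finite_surj[OF finW])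
  have "card (reduced_forms (int n)) \<le> card W" using sub finW by (rule surj_card_le[rotated])
  also have "\<dots> \<le> (\<Sum>g | g dvd n. card (Sigma (E g) M))"
    unfolding W_def using fin_div by (rule card_UN_le)
  also have "\<dots> \<le> (\<Sum>g | g dvd n. g * card (D g))"
  proof (intro sum_mono)
    fix g assume "g \<in> {g. g dvd n}"
    then have g: "g dvd n" "g > 0" using dpos by auto
    have "card (Sigma (E g) M) = (\<Sum>w\<in>E g. card (M w))"
      using fin_E[OF g(1)] M(1) by (intro card_SigmaI) auto
    also have "\<dots> \<le> (\<Sum>w\<in>E g. g)" using M(2) by (intro sum_mono) auto
    also have "\<dots> \<le> g * card (D g)" using card_mono[OF D(1)[OF g(2)] E_sub] by simp
    finally show "card (Sigma (E g) M) \<le> g * card (D g)" .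
  qed
  finally have "real (card (reduced_forms (int n))) \<le> real (\<Sum>g | g dvd n. g * card (D g))"
    by (simp only: of_nat_le_iff)
  also have "\<dots> = (\<Sum>g | g dvd n. real g * real (card (D g)))" by simp
  also have "\<dots> \<le> (\<Sum>g | g dvd n. real g * (18 * real n / (real g)\<^sup>2))"
    using D(2) dpos by (intro sum_mono mult_left_mono) auto
  also have "\<dots> = 18 * real n * (\<Sum>g | g dvd n. 1 / real g)"
    unfolding sum_distrib_left
  proof (intro sum.cong refl)
    fix g assume "g \<in> {g. g dvd n}"
    then have "g \<noteq> 0" using dpos by auto
    then show "real g * (18 * real n / (real g)\<^sup>2) = 18 * real n * (1 / real g)"
      by (simp add: power2_eq_square)
  qed
  finally show "real (card (reduced_forms (int n))) \<le> 18 * real n * (\<Sum>g | g dvd n. 1 / real g)" .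
qed

section \<open>Reduced forms from lattices of index \<open>n\<close>\<close>

definition norm_units :: "nat \<Rightarrow> (nat \<times> nat) set" where
  "norm_units n = {(u, v). u < n \<and> v < n \<and> coprime (u\<^sup>2 + v\<^sup>2) n}"

lemma finite_norm_units [simp]: "finite (norm_units n)"
  by (rule finite_subset[of _ "{..<n} \<times> {..<n}"]) (auto simp: norm_units_def)

text \<open>Each a determines b modulo p up to sign, and a = 0 forces b = 0, so there are at most 1
  + 2 (p - 1) pairs.\<close>

lemma card_isotropic_le:
  assumes "prime (p::nat)"
  shows "card {(a, b). a < p \<and> b < p \<and> p dvd a\<^sup>2 + b\<^sup>2} \<le> 2 * p - 1"
proof -
  define Z where "Z = (\<lambda>a. {b. b < p \<and> p dvd a\<^sup>2 + b\<^sup>2})"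
  have p0: "p > 0" using assms prime_gt_0_nat by blast
  have Z2: "card (Z a) \<le> 2" for a
  proof (cases "Z a = {}")
    case False
    then obtain b where b: "b < p" "p dvd a\<^sup>2 + b\<^sup>2" by (auto simp: Z_def)
    have "Z a \<subseteq> {b, p - b}"
    proof
      fix c assume "c \<in> Z a"
      then have c: "c < p" "p dvd a\<^sup>2 + c\<^sup>2" by (auto simp: Z_def)
      have "int p dvd int (a\<^sup>2 + c\<^sup>2) - int (a\<^sup>2 + b\<^sup>2)"
        using b c by (intro dvd_diff) (simp_all only: of_nat_dvd_iff)
      also have "int (a\<^sup>2 + c\<^sup>2) - int (a\<^sup>2 + b\<^sup>2) = (int c - int b) * (int c + int b)"
        by (simp add: power2_eq_square algebra_simps)
      finally have "int p dvd int c - int b \<or> int p dvd int c + int b"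
        using assms by (simp add: prime_dvd_mult_iff)
      then show "c \<in> {b, p - b}"
      proof
        assume "int p dvd int c - int b"
        moreover have "\<bar>int c - int b\<bar> < int p" using b c by linarith
        ultimately have "int c - int b = 0" using zdvd_not_zless[of "\<bar>int c - int b\<bar>" "int p"] by force
        then show ?thesis by simp
      next
        assume "int p dvd int c + int b"
        then have "p dvd c + b" by (simp flip: of_nat_add)
        then obtain k where k: "c + b = p * k" by (auto elim: dvdE)
        then have "p * k < p * 2" using b c by linarith
        then have "k = 0 \<or> k = 1" by auto
        then show ?thesis using k b by auto
      qed
    qed
    then have "card (Z a) \<le> card {b, p - b}" by (intro card_mono) auto
    also have "\<dots> \<le> 2" by (auto simp: card_insert_if)
    finally show ?thesis .
  qed auto
  have "Z 0 \<subseteq> {0}"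
  proof
    fix b assume "b \<in> Z 0"
    then have "b < p" "p dvd b" using assms prime_dvd_power by (auto simp: Z_def)
    then show "b \<in> {0}" using nat_dvd_not_less by auto
  qed
  then have Z0: "card (Z 0) \<le> 1" using card_mono[of "{0::nat}" "Z 0"] by simp
  have "{(a, b). a < p \<and> b < p \<and> p dvd a\<^sup>2 + b\<^sup>2} = Sigma {..<p} Z" by (auto simp: Z_def)
  then have "card {(a, b). a < p \<and> b < p \<and> p dvd a\<^sup>2 + b\<^sup>2} = (\<Sum>a<p. card (Z a))"
    by (simp add: card_SigmaI Z_def)
  also have "\<dots> = card (Z 0) + (\<Sum>a\<in>{1..<p}. card (Z a))"
    using p0 by (simp add: lessThan_atLeast0 sum.atLeast_Suc_lessThan)
  also have "\<dots> \<le> 1 + (\<Sum>a\<in>{1..<p}. 2)" using Z0 Z2 by (intro add_mono sum_mono) auto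
  also have "\<dots> = 2 * p - 1" using p0 by simp
  finally show ?thesis .
qed

text \<open>A pair modulo n is lifted by adding n (i, j) with i, j < p. If p divides n, all p^2
  lifts keep a norm prime to p. Otherwise at most 2p - 1 lifts are isotropic modulo p, which leaves
  p^2 - (2p - 1) = (p - 1)^2.\<close>

lemma card_norm_units_prime_mult:
  assumes "prime p" "n > 0"
  shows "(if p dvd n then p else p - 1)\<^sup>2 * card (norm_units n) \<le> card (norm_units (p * n))"
proof -
  define G where "G = (\<lambda>(u, v). {(i, j). i < p \<and> j < p \<and> \<not> p dvd (u + n * i)\<^sup>2 + (v + n * j)\<^sup>2})"
  define h where "h = (\<lambda>((u, v), (i, j)). (u + n * i, v + n * j) :: nat \<times> nat)"
  define c where "c = (if p dvd n then p else p - 1)\<^sup>2"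
  have p0: "p > 0" using assms prime_gt_0_nat by blast
  have expand: "(u + n * i)\<^sup>2 + (v + n * j)\<^sup>2 = (2 * u * i + n * i\<^sup>2 + 2 * v * j + n * j\<^sup>2) * n + (u\<^sup>2 + v\<^sup>2)"
    for u v i j by (simp add: power2_eq_square algebra_simps)
  have finG: "finite (G w)" for w
    by (rule finite_subset[of _ "{..<p} \<times> {..<p}"]) (auto simp: G_def case_prod_unfold)
  have cardG: "c \<le> card (G w)" if w_in: "w \<in> norm_units n" for w
  proof -
    obtain u v where w: "w = (u, v)" "coprime (u\<^sup>2 + v\<^sup>2) n"
      using w_in by (cases w) (auto simp: norm_units_def)
    show ?thesis
    proof (cases "p dvd n")
      case True
      have "\<not> p dvd u\<^sup>2 + v\<^sup>2"
        using w(2) True assms(1) by (meson coprime_common_divisor not_prime_unit)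
      then have "\<not> p dvd (u + n * i)\<^sup>2 + (v + n * j)\<^sup>2" for i j
        unfolding expand using True by (simp add: dvd_add_right_iff)
      then have "G w = {..<p} \<times> {..<p}" by (auto simp: G_def w)
      then show ?thesis using True by (simp add: c_def power2_eq_square card_cartesian_product)
    next
      case False
      define B where "B = {(i, j). i < p \<and> j < p \<and> p dvd (u + n * i)\<^sup>2 + (v + n * j)\<^sup>2}"
      have finB: "finite B" by (rule finite_subset[of _ "{..<p} \<times> {..<p}"]) (auto simp: B_def)
      \<comment> \<open>As n is invertible modulo p, different lifts have different residues, so the
        bad lifts inject into the isotropic pairs.\<close>
      have inj: "i = i'" if "(a + n * i) mod p = (a + n * i') mod p" "i < p" "i' < p" for a i i'
      proof -
        have "[a + n * i = a + n * i'] (mod p)" using that(1) by (simp add: cong_def)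
        then have "[n * i = n * i'] (mod p)" by (simp add: cong_add_lcancel_nat)
        moreover have "coprime n p" using prime_imp_coprime[OF assms(1) False] by (simp add: coprime_commute)
        ultimately have "[i = i'] (mod p)" by (simp add: cong_mult_lcancel_nat)
        then show ?thesis using that by (simp add: cong_less_modulus_unique_nat)
      qed
      have "card B \<le> card {(a, b). a < p \<and> b < p \<and> p dvd a\<^sup>2 + b\<^sup>2}"
      proof (rule card_inj_on_le)
        show "inj_on (\<lambda>(i, j). ((u + n * i) mod p, (v + n * j) mod p)) B"
          by (auto simp: inj_on_def B_def dest: inj)
        show "(\<lambda>(i, j). ((u + n * i) mod p, (v + n * j) mod p)) ` B
            \<subseteq> {(a, b). a < p \<and> b < p \<and> p dvd a\<^sup>2 + b\<^sup>2}"
        proof -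
          have "((a mod p)\<^sup>2 + (b mod p)\<^sup>2) mod p = (a\<^sup>2 + b\<^sup>2) mod p" for a b
            by (rule mod_add_cong) (simp_all only: power_mod)
          then have dvd: "p dvd (a mod p)\<^sup>2 + (b mod p)\<^sup>2 \<longleftrightarrow> p dvd a\<^sup>2 + b\<^sup>2" for a b
            by (simp only: dvd_eq_mod_eq_0)
          show ?thesis
          proof (rule image_subsetI)
            fix z assume "z \<in> B"
            then obtain i j where "z = (i, j)" "p dvd (u + n * i)\<^sup>2 + (v + n * j)\<^sup>2"
              unfolding B_def by blast
            then show "(\<lambda>(i, j). ((u + n * i) mod p, (v + n * j) mod p)) z
                \<in> {(a, b). a < p \<and> b < p \<and> p dvd a\<^sup>2 + b\<^sup>2}"
              using p0 by (simp only: prod.case mem_Collect_eq dvd mod_less_divisor simp_thms)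
          qed
        qed
        show "finite {(a, b). a < p \<and> b < p \<and> p dvd a\<^sup>2 + b\<^sup>2}"
          by (rule finite_subset[of _ "{..<p} \<times> {..<p}"]) auto
      qed
      then have B: "card B \<le> 2 * p - 1" using card_isotropic_le[OF assms(1)] by simp
      have "G w = {..<p} \<times> {..<p} - B" by (auto simp: G_def B_def w)
      moreover have "B \<subseteq> {..<p} \<times> {..<p}" by (auto simp: B_def)
      ultimately have "card (G w) = p * p - card B"
        using finB by (simp add: card_Diff_subset card_cartesian_product)
      moreover have "(p - 1)\<^sup>2 = p * p - (2 * p - 1)"
        using p0 by (cases p) (auto simp: power2_eq_square)
      ultimately show ?thesis using B False by (simp add: c_def)
    qed
  qed
  have inj: "inj_on h (Sigma (norm_units n) G)"
  proof -
    have eqD: "u = u' \<and> i = i'" if "u + n * i = u' + n * i'" "u < n" "u' < n" for u i u' i' :: nat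
    proof -
      have "(u + n * i) mod n = u" "(u' + n * i') mod n = u'" using that(2,3) by simp_all
      then have "u = u'" using that(1) by simp
      then show ?thesis using that assms(2) by simp
    qed
    show ?thesis
    proof (rule inj_onI)
      fix z z' assume z: "z \<in> Sigma (norm_units n) G" "z' \<in> Sigma (norm_units n) G" and eq: "h z = h z'"
      obtain u v i j u' v' i' j' where zz: "z = ((u, v), (i, j))" "z' = ((u', v'), (i', j'))"
        by (metis surj_pair)
      have "u < n" "v < n" "u' < n" "v' < n" using z by (auto simp: zz norm_units_def)
      moreover have "u + n * i = u' + n * i'" "v + n * j = v' + n * j'"
        using eq by (simp_all add: h_def zz)
      ultimately have "u = u' \<and> i = i'" "v = v' \<and> j = j'"
        using eqD[of u i u' i'] eqD[of v j v' j'] by blast+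
      then show "z = z'" by (simp add: zz)
    qed
  qed
  have sub: "h ` Sigma (norm_units n) G \<subseteq> norm_units (p * n)"
  proof
    fix z assume "z \<in> h ` Sigma (norm_units n) G"
    then obtain u v i j where z: "z = (u + n * i, v + n * j)" "u < n" "v < n" "i < p" "j < p"
      "coprime (u\<^sup>2 + v\<^sup>2) n" "\<not> p dvd (u + n * i)\<^sup>2 + (v + n * j)\<^sup>2"
      by (auto simp: h_def norm_units_def G_def)
    have less: "a + n * b < p * n" if "a < n" "b < p" for a b :: nat
    proof -
      have "a + n * b < n * (b + 1)" using that by simp
      also have "\<dots> \<le> n * p" using that by (intro mult_left_mono) auto
      finally show ?thesis by (simp add: mult.commute)
    qed
    have "coprime ((u + n * i)\<^sup>2 + (v + n * j)\<^sup>2) p"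
      using prime_imp_coprime[OF assms(1) z(7)] by (simp add: coprime_commute)
    moreover have "coprime n ((u + n * i)\<^sup>2 + (v + n * j)\<^sup>2)"
      unfolding expand coprime_iff_gcd_eq_1 gcd_add_mult
      using z(6) by (metis coprime_iff_gcd_eq_1 gcd.commute)
    ultimately show "z \<in> norm_units (p * n)"
      using less z(2-5) by (simp add: z(1) norm_units_def coprime_commute)
  qed
  have "c * card (norm_units n) = (\<Sum>w\<in>norm_units n. c)" by simp
  also have "\<dots> \<le> (\<Sum>w\<in>norm_units n. card (G w))" using cardG by (rule sum_mono)
  also have "\<dots> = card (Sigma (norm_units n) G)" using finG by (subst card_SigmaI) auto
  also have "\<dots> \<le> card (norm_units (p * n))" using inj sub by (rule card_inj_on_le) simp
  finally show ?thesis by (simp add: c_def)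
qed

lemma totient_prime_mult:
  assumes "prime p"
  shows "totient (p * n) = (if p dvd n then p else p - 1) * totient n"
proof (cases "p dvd n")
  case True
  then have "gcd p n = p" by (simp add: gcd_nat.absorb1)
  then have "totient (p * n) * totient p = totient p * totient n * p" using totient_gcd[of p n] by simp
  then have "totient p * totient (p * n) = totient p * (p * totient n)" by (simp add: mult_ac)
  moreover have "totient p > 0" using assms prime_gt_0_nat by simp
  ultimately show ?thesis using True by simp
next
  case False
  then show ?thesis using prime_imp_coprime[OF assms False] assms
    by (simp add: totient_mult_coprime totient_prime)
qed

text \<open>Adding one prime at a time, the squared totient grows by exactly the factor that bounds
  the growth of the unit pairs from below.\<close>

lemma totient_squared_le_card_norm_units:
  assumes "n > 0"
  shows "(totient n)\<^sup>2 \<le> card (norm_units n)"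
  using assms
proof (induction n rule: prime_divisors_induct)
  case (unit n)
  then have "n = 1" by simp
  then have "norm_units n = {(0, 0)}" by (auto simp: norm_units_def)
  then show ?case using \<open>n = 1\<close> by simp
next
  case (factor p n)
  then have n0: "n > 0" and IH: "(totient n)\<^sup>2 \<le> card (norm_units n)" by auto
  define k where "k = (if p dvd n then p else p - 1)"
  have "(totient (p * n))\<^sup>2 = k\<^sup>2 * (totient n)\<^sup>2"
    using totient_prime_mult[OF factor.hyps(1), of n] by (simp add: k_def power_mult_distrib)
  also have "\<dots> \<le> k\<^sup>2 * card (norm_units n)" using IH by simp
  also have "\<dots> \<le> card (norm_units (p * n))"
    unfolding k_def by (rule card_norm_units_prime_mult) (use factor n0 in auto)
  finally show ?case .
qed simp

section \<open>Reduced lattice bases and the forms they determine\<close>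

text \<open>A reduced basis of the lattice of all \<open>w\<close> whose determinant with \<open>z = (u, v)\<close> is divisible
  by \<open>n\<close>.\<close>
definition reduced_basis :: "int \<Rightarrow> int \<Rightarrow> int \<Rightarrow> int \<Rightarrow> int \<Rightarrow> int \<Rightarrow> int \<Rightarrow> bool" where
  "reduced_basis n u v p q r s \<longleftrightarrow>
     p * s - q * r = n \<and> n dvd p * v - q * u \<and> n dvd r * v - s * u \<and>
     2 * \<bar>p * r + q * s\<bar> \<le> p\<^sup>2 + q\<^sup>2 \<and> p\<^sup>2 + q\<^sup>2 \<le> r\<^sup>2 + s\<^sup>2"

text \<open>A shortest nonzero lattice vector (p, q) is completed to determinant n by Bezout's
  identity, and the inner product is then centered. The second vector is a nonzero lattice vector
  too, hence not shorter.\<close>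

lemma exists_reduced_basis:
  assumes "n > 0"
  shows "\<exists>p q r s. reduced_basis n u v p q r s"
proof -
  define S where "S = {(p, q). (p, q) \<noteq> (0, 0) \<and> n dvd p * v - q * u}"
  define f where "f = (\<lambda>(p, q). nat (p\<^sup>2 + q\<^sup>2) :: nat)"
  have "(n, 0) \<in> S" using assms by (auto simp: S_def)
  then obtain w where w: "w \<in> S" "\<And>w'. w' \<in> S \<Longrightarrow> f w \<le> f w'"
    using ex_has_least_nat[of "\<lambda>w. w \<in> S" _ f] by blast
  obtain p q where pq: "w = (p, q)" by (cases w)
  have min: "p\<^sup>2 + q\<^sup>2 \<le> p'\<^sup>2 + q'\<^sup>2" if "(p', q') \<in> S" for p' q'
    using w(2)[OF that] by (simp add: f_def pq nat_le_eq_zle)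
  have nz: "p \<noteq> 0 \<or> q \<noteq> 0" and dv: "n dvd p * v - q * u" using w(1) pq by (auto simp: S_def)
  then have x0: "p\<^sup>2 + q\<^sup>2 > 0" by (simp add: sum_power2_gt_zero_iff)
  obtain e where e: "p * v - q * u = n * e" using dv by (auto elim: dvdE)
  \<comment> \<open>Dividing (p, q) by d stays in the lattice because d also divides e; minimality
    therefore forces d = 1.\<close>
  define d where "d = gcd p (gcd q e)"
  have d0: "d > 0" using nz by (auto simp: d_def)
  obtain p' q' e' where d: "p = d * p'" "q = d * q'" "e = d * e'"
    by (metis d_def dvdE gcd_dvd1 gcd_dvd2 dvd_trans)
  have "d * (p' * v - q' * u) = d * (n * e')" using e unfolding d(1,2,3) by (simp add: algebra_simps)
  then have "p' * v - q' * u = n * e'" using d0 by simp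
  then have "(p', q') \<in> S" using nz d by (auto simp: S_def)
  then have "d\<^sup>2 * (p'\<^sup>2 + q'\<^sup>2) \<le> 1 * (p'\<^sup>2 + q'\<^sup>2)" using min unfolding d(1,2)
    by (simp add: power_mult_distrib distrib_left)
  moreover have "p'\<^sup>2 + q'\<^sup>2 > 0" using nz d by (auto simp: sum_power2_gt_zero_iff)
  ultimately have "d\<^sup>2 \<le> 1" by (simp only: mult_le_cancel_right_pos)
  then have "d = 1" using d0 power2_le_imp_le[of d 1] by simp
  obtain i t where "i * p + t * gcd q e = d" using bezout_int[of p "gcd q e"] unfolding d_def by blast
  moreover obtain j k where "j * q + k * e = gcd q e" using bezout_int[of q e] by blast
  ultimately have "i * p + t * (j * q + k * e) = 1" using \<open>d = 1\<close> by simp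
  then have bez: "i * p + (t * j) * q + (t * k) * e = 1" by (simp add: algebra_simps)
  define J K where JK: "J = t * j" "K = t * k"
  \<comment> \<open>A combination of the lattice vectors (n, 0), (0, n) and (u, v), whose
    determinant with (p, q) is n times the Bezout sum.\<close>
  define r0 s0 where rs0: "r0 = - J * n + K * u" "s0 = i * n + K * v"
  have "p * s0 - q * r0 = n * (i * p + J * q) + K * (p * v - q * u)"
    unfolding rs0 by (simp add: algebra_simps)
  also have "\<dots> = n * (i * p + J * q + K * e)" unfolding e by (simp add: algebra_simps)
  finally have det0: "p * s0 - q * r0 = n" using bez by (simp add: JK)
  obtain l where l: "2 * \<bar>(p * r0 + q * s0) + l * (p\<^sup>2 + q\<^sup>2)\<bar> \<le> p\<^sup>2 + q\<^sup>2"
    using exists_centered_residue[OF x0] by blast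
  define r s where rs: "r = r0 + l * p" "s = s0 + l * q"
  have det: "p * s - q * r = n" using det0 unfolding rs by (simp add: algebra_simps)
  have "r * v - s * u = n * (- J * v - i * u) + l * (p * v - q * u)"
    unfolding rs rs0 by (simp add: algebra_simps)
  also have "n dvd \<dots>" using dv by simp
  finally have L: "n dvd r * v - s * u" .
  have m: "2 * \<bar>p * r + q * s\<bar> \<le> p\<^sup>2 + q\<^sup>2"
    using l unfolding rs by (simp add: algebra_simps power2_eq_square)
  have "(r, s) \<in> S" using det L assms by (auto simp: S_def)
  then have "p\<^sup>2 + q\<^sup>2 \<le> r\<^sup>2 + s\<^sup>2" by (rule min)
  then show ?thesis using det dv L m unfolding reduced_basis_def by blast
qed

text \<open>Cramer's rule: the coordinates are determinants divided by n, and the two divisibility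
  conditions make them integral.\<close>

lemma reduced_basis_coordinates:
  assumes "reduced_basis n u v p q r s" "n > 0"
  obtains a b where "u = a * p + b * r" "v = a * q + b * s"
proof -
  have det: "p * s - q * r = n" using assms by (simp add: reduced_basis_def)
  obtain b where b: "p * v - q * u = n * b" using assms by (auto simp: reduced_basis_def elim: dvdE)
  obtain c where c: "r * v - s * u = n * c" using assms by (auto simp: reduced_basis_def elim: dvdE)
  have "n * u = (p * v - q * u) * r - (r * v - s * u) * p" unfolding det[symmetric] by (simp add: algebra_simps)
  also have "\<dots> = n * (- c * p + b * r)" unfolding b c by (simp add: algebra_simps)
  finally have u: "u = - c * p + b * r" using assms(2) by simp
  have "n * v = (p * v - q * u) * s - (r * v - s * u) * q" unfolding det[symmetric] by (simp add: algebra_simps)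
  also have "\<dots> = n * (- c * q + b * s)" unfolding b c by (simp add: algebra_simps)
  finally have "v = - c * q + b * s" using assms(2) by simp
  then show ?thesis using u that by blast
qed

lemma coprime_dvd_mult_cancel:
  fixes N n x E :: int
  assumes "coprime N n" "x dvd N * E" "x dvd n * E"
  shows "x dvd E"
proof -
  obtain g h where "g * N + h * n = 1" using assms(1) bezout_int[of N n] by (auto simp: coprime_iff_gcd_eq_1)
  then have "E = g * (N * E) + h * (n * E)" by (metis distrib_right mult.assoc mult_1)
  then show ?thesis using assms by (metis dvd_add dvd_mult)
qed

text \<open>These are the four units of the Gaussian integers, written as real and imaginary
  parts.\<close>

lemma sum_squares_eq_1:
  fixes e f :: int
  assumes "e\<^sup>2 + f\<^sup>2 = 1"
  shows "(e, f) \<in> {(1, 0), (0, 1), (-1, 0), (0, -1)}"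
proof -
  have "e\<^sup>2 \<le> 1" "f\<^sup>2 \<le> 1" using assms zero_le_power2[of e] zero_le_power2[of f] by linarith+
  then have "\<bar>e\<bar> \<le> 1" "\<bar>f\<bar> \<le> 1" by (simp_all add: abs_square_le_1)
  then have "e \<in> {-1, 0, 1}" "f \<in> {-1, 0, 1}" by auto
  then show ?thesis using assms by auto
qed

text \<open>In the Gaussian integers put \<open>\<alpha> = p + i q\<close>, \<open>\<beta> = r + i s\<close>. Equal Gram matrices mean
  \<open>x \<alpha>' = (E + i F) \<alpha>\<close> and \<open>x \<beta>' = (E + i F) \<beta>\<close> with \<open>E + i F = conj \<alpha> \<alpha>'\<close>. The lattice spanned by
  \<open>\<alpha>, \<beta>\<close> contains \<open>n\<close> and \<open>u + i v\<close>, whose norm is prime to \<open>n\<close>, so it generates the unit ideal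
  and \<open>x\<close> divides \<open>E + i F\<close>.\<close>
lemma same_gram_matrix_imp_rotation:
  assumes basis: "reduced_basis n u v p q r s" "reduced_basis n u' v' p' q' r' s'"
    and n: "n > 0" and cop: "coprime (u\<^sup>2 + v\<^sup>2) n"
    and x: "p\<^sup>2 + q\<^sup>2 = p'\<^sup>2 + q'\<^sup>2" and m: "p * r + q * s = p' * r' + q' * s'"
  obtains e f k where "(e, f) \<in> {(1, 0), (0, 1), (-1, 0), (0, -1)}"
    "n dvd u' - k * (e * u - f * v)" "n dvd v' - k * (f * u + e * v)"
proof -
  have det: "p * s - q * r = n" "p' * s' - q' * r' = n" using basis by (auto simp: reduced_basis_def)
  define X E F where "X = p\<^sup>2 + q\<^sup>2" and "E = p * p' + q * q'" and "F = p * q' - q * p'"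
  note defs = this
  have X': "X = p'\<^sup>2 + q'\<^sup>2" using x by (simp add: X_def)
  have X0: "X \<noteq> 0" using det(1) n by (auto simp: X_def sum_power2_eq_zero_iff)
  have a1: "X * p' = E * p - F * q" and a2: "X * q' = E * q + F * p"
    unfolding defs by (simp_all add: power2_eq_square algebra_simps)
  define M where "M = p * r + q * s"
  have M': "M = p' * r' + q' * s'" using m by (simp add: M_def)
  \<comment> \<open>The Gram data recover the second vector from the first: X \<beta> = (M + i n)
    \<alpha>.\<close>
  have b1: "X * r = M * p - n * q" "X * s = M * q + n * p"
    unfolding X_def M_def det(1)[symmetric] by (simp_all add: power2_eq_square algebra_simps)
  have b2: "X * r' = M * p' - n * q'" "X * s' = M * q' + n * p'"
    unfolding X' M' det(2)[symmetric] by (simp_all add: power2_eq_square algebra_simps)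
  have "X * (X * r') = M * (X * p') - n * (X * q')" unfolding b2 by (simp add: algebra_simps)
  also have "\<dots> = E * (X * r) - F * (X * s)" unfolding a1 a2 b1 by (simp add: algebra_simps)
  finally have "X * (X * r') = X * (E * r - F * s)" by (simp add: algebra_simps)
  then have a3: "X * r' = E * r - F * s" using X0 by simp
  have "X * (X * s') = M * (X * q') + n * (X * p')" unfolding b2 by (simp add: algebra_simps)
  also have "\<dots> = E * (X * s) + F * (X * r)" unfolding a1 a2 b1 by (simp add: algebra_simps)
  finally have "X * (X * s') = X * (E * s + F * r)" by (simp add: algebra_simps)
  then have a4: "X * s' = E * s + F * r" using X0 by simp
  obtain a b where ab: "u = a * p + b * r" "v = a * q + b * s"
    using reduced_basis_coordinates[OF basis(1) n] by blast
  obtain a' b' where ab': "u' = a' * p' + b' * r'" "v' = a' * q' + b' * s'"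
    using reduced_basis_coordinates[OF basis(2) n] by blast
  have "E * u - F * v = a * (X * p') + b * (X * r')"
    unfolding a1 a3 unfolding ab by (simp add: algebra_simps)
  then have c1: "E * u - F * v = X * (a * p' + b * r')" by (simp add: algebra_simps)
  have "F * u + E * v = a * (X * q') + b * (X * s')"
    unfolding a2 a4 unfolding ab by (simp add: algebra_simps)
  then have c2: "F * u + E * v = X * (a * q' + b * s')" by (simp add: algebra_simps)
  \<comment> \<open>Multiplying E + i F by u + i v gives a multiple of X; the conjugate of u + i v
    then turns this into divisibility for the norm u^2 + v^2.\<close>
  have "(u\<^sup>2 + v\<^sup>2) * E = u * (E * u - F * v) + v * (F * u + E * v)"
    by (simp add: power2_eq_square algebra_simps)
  then have d1: "X dvd (u\<^sup>2 + v\<^sup>2) * E" unfolding c1 c2 by simp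
  have "(u\<^sup>2 + v\<^sup>2) * F = u * (F * u + E * v) - v * (E * u - F * v)"
    by (simp add: power2_eq_square algebra_simps)
  then have d2: "X dvd (u\<^sup>2 + v\<^sup>2) * F" unfolding c1 c2 by simp
  have "n * E = s * (X * p') - q * (X * r')" unfolding a1 a3 det(1)[symmetric] by (simp add: algebra_simps)
  then have d3: "X dvd n * E" by simp
  have "n * F = s * (X * q') - q * (X * s')" unfolding a2 a4 det(1)[symmetric] by (simp add: algebra_simps)
  then have d4: "X dvd n * F" by simp
  obtain e where e: "E = X * e" using coprime_dvd_mult_cancel[OF cop d1 d3] by (auto elim: dvdE)
  obtain f where f: "F = X * f" using coprime_dvd_mult_cancel[OF cop d2 d4] by (auto elim: dvdE)
  have "E\<^sup>2 + F\<^sup>2 = (p\<^sup>2 + q\<^sup>2) * (p'\<^sup>2 + q'\<^sup>2)" unfolding defs by (simp add: power2_eq_square algebra_simps)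
  also have "\<dots> = X * X" unfolding x by (simp add: X')
  finally have "X * X * (e\<^sup>2 + f\<^sup>2) = X * X * 1" unfolding e f by (simp add: power2_eq_square algebra_simps)
  then have ef: "e\<^sup>2 + f\<^sup>2 = 1" using X0 by (simp only: mult_cancel_left) simp
  have "X * p' = X * (e * p - f * q)" "X * q' = X * (e * q + f * p)"
    "X * r' = X * (e * r - f * s)" "X * s' = X * (e * s + f * r)"
    unfolding a1 a2 a3 a4 e f by (simp_all add: algebra_simps)
  then have rot: "p' = e * p - f * q" "q' = e * q + f * p" "r' = e * r - f * s" "s' = e * s + f * r"
    using X0 by simp_all
  \<comment> \<open>w1 + i w2 is u' + i v' rotated back into the first lattice, where it must be a
    multiple of u + i v modulo n.\<close>
  define w1 w2 where "w1 = a' * p + b' * r" and "w2 = a' * q + b' * s"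
  note w = this
  have z': "u' = e * w1 - f * w2" "v' = f * w1 + e * w2"
    unfolding ab' rot w by (simp_all add: algebra_simps)
  have "w1 * v - w2 * u = a' * (p * v - q * u) + b' * (r * v - s * u)"
    unfolding w by (simp add: algebra_simps)
  then have L: "n dvd w1 * v - w2 * u" using basis(1) by (auto simp: reduced_basis_def)
  obtain g h where gh: "g * (u\<^sup>2 + v\<^sup>2) + h * n = 1"
    using cop bezout_int[of "u\<^sup>2 + v\<^sup>2" n] by (auto simp: coprime_iff_gcd_eq_1)
  \<comment> \<open>Modulo n this is the quotient of w1 + i w2 by u + i v: g inverts the norm, and
    the imaginary part of the quotient vanishes by the lattice condition.\<close>
  define k where "k = g * (w1 * u + w2 * v)"
  have "w1 - k * u = (g * (u\<^sup>2 + v\<^sup>2) + h * n) * w1 - k * u" unfolding gh by simp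
  also have "\<dots> = n * (h * w1) + g * v * (w1 * v - w2 * u)"
    unfolding k_def by (simp add: power2_eq_square algebra_simps)
  also have "n dvd \<dots>" using L by simp
  finally have k1: "n dvd w1 - k * u" .
  have "w2 - k * v = (g * (u\<^sup>2 + v\<^sup>2) + h * n) * w2 - k * v" unfolding gh by simp
  also have "\<dots> = n * (h * w2) - g * u * (w1 * v - w2 * u)"
    unfolding k_def by (simp add: power2_eq_square algebra_simps)
  also have "n dvd \<dots>" using L by simp
  finally have k2: "n dvd w2 - k * v" .
  have "u' - k * (e * u - f * v) = e * (w1 - k * u) - f * (w2 - k * v)"
    unfolding z' by (simp add: algebra_simps)
  then have "n dvd u' - k * (e * u - f * v)" using k1 k2 by simp
  moreover have "v' - k * (f * u + e * v) = f * (w1 - k * u) + e * (w2 - k * v)"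
    unfolding z' by (simp add: algebra_simps)
  then have "n dvd v' - k * (f * u + e * v)" using k1 k2 by simp
  ultimately show ?thesis using sum_squares_eq_1[OF ef] that by blast
qed

section \<open>Counting fibres for the lower bound\<close>

lemma card_le_mult_card_image:
  assumes "finite A" "\<And>y. y \<in> f ` A \<Longrightarrow> card {x \<in> A. f x = y} \<le> k"
  shows "card A \<le> k * card (f ` A)"
proof -
  have "card A = card (\<Union>y\<in>f ` A. {x \<in> A. f x = y})" by (rule arg_cong[of _ _ card]) auto
  also have "\<dots> \<le> (\<Sum>y\<in>f ` A. card {x \<in> A. f x = y})" using assms(1) by (intro card_UN_le) auto
  also have "\<dots> \<le> (\<Sum>y\<in>f ` A. k)" using assms(2) by (intro sum_mono) auto
  finally show ?thesis by (simp add: mult.commute)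
qed

text \<open>The norm u^2 + v^2 is a value of the form with Gram matrix entries x, m, y, so a divisor
  common to these and n divides both the norm and n.\<close>

lemma reduced_basis_form:
  assumes "reduced_basis n u v p q r s" "n > 0" "coprime (u\<^sup>2 + v\<^sup>2) n"
  shows "(p\<^sup>2 + q\<^sup>2, \<bar>p * r + q * s\<bar>, r\<^sup>2 + s\<^sup>2) \<in> reduced_forms n"
proof -
  obtain a b where ab: "u = a * p + b * r" "v = a * q + b * s"
    using reduced_basis_coordinates[OF assms(1,2)] by blast
  have R: "p * s - q * r = n" "2 * \<bar>p * r + q * s\<bar> \<le> p\<^sup>2 + q\<^sup>2" "p\<^sup>2 + q\<^sup>2 \<le> r\<^sup>2 + s\<^sup>2"
    using assms(1) by (auto simp: reduced_basis_def)
  have "(p\<^sup>2 + q\<^sup>2) * (r\<^sup>2 + s\<^sup>2) = n\<^sup>2 + \<bar>p * r + q * s\<bar>\<^sup>2"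
    unfolding R(1)[symmetric] power2_abs by (simp add: power2_eq_square algebra_simps)
  moreover have "is_unit d"
    if d: "d dvd p\<^sup>2 + q\<^sup>2" "d dvd r\<^sup>2 + s\<^sup>2" "d dvd \<bar>p * r + q * s\<bar>" "d dvd n" for d
  proof -
    have "u\<^sup>2 + v\<^sup>2 = a\<^sup>2 * (p\<^sup>2 + q\<^sup>2) + 2 * a * b * (p * r + q * s) + b\<^sup>2 * (r\<^sup>2 + s\<^sup>2)"
      unfolding ab by (simp add: power2_eq_square algebra_simps)
    also have "d dvd \<dots>"
      by (rule dvd_add[OF dvd_add[OF dvd_mult dvd_mult] dvd_mult]) (use d in simp_all)
    finally show ?thesis using d(4) assms(3) coprime_common_divisor by blast
  qed
  ultimately show ?thesis using R(2,3) unfolding reduced_forms_def by auto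
qed

text \<open>Unit pairs are mapped to the Gram data of a chosen basis. A fibre has at most four
  rotations times \<open>totient n\<close> scalars, and the sign of m at most doubles the image,
  whence the factor 8.\<close>

lemma totient_le_card_reduced_forms:
  assumes "n > (1::nat)" "finite (reduced_forms (int n))"
  shows "totient n \<le> 8 * card (reduced_forms (int n))"
proof -
  define B where "B = (\<lambda>(u, v). SOME (p, q, r, s). reduced_basis (int n) (int u) (int v) p q r s)"
  have B: "case B (u, v) of (p, q, r, s) \<Rightarrow> reduced_basis (int n) (int u) (int v) p q r s" for u v
  proof -
    obtain p q r s where "reduced_basis (int n) (int u) (int v) p q r s"
      using exists_reduced_basis[of "int n" "int u" "int v"] assms(1) by auto
    then show ?thesis unfolding B_def prod.case
      by (intro someI[of "\<lambda>(p, q, r, s). reduced_basis (int n) (int u) (int v) p q r s" "(p, q, r, s)"]) simp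
  qed
  \<comment> \<open>The third entry r^2 + s^2 is dropped, being determined by the other two and
    n.\<close>
  define \<Phi> where "\<Phi> = (\<lambda>z. case B z of (p, q, r, s) \<Rightarrow> (p\<^sup>2 + q\<^sup>2, p * r + q * s))"
  define U where "U = norm_units n"
  define R where "R = reduced_forms (int n)"
  define T :: "(int \<times> int) set" where "T = {(1, 0), (0, 1), (-1, 0), (0, -1)}"
  define K where "K = {k. k < n \<and> coprime k n}"
  have K_sub: "K \<subseteq> totatives n"
    using assms by (auto simp: K_def in_totatives_iff intro!: Nat.gr0I)
  then have finK: "finite K" and cardK: "card K \<le> totient n"
    using finite_subset[OF K_sub] card_mono[OF _ K_sub] by (auto simp: totient_def)
  have "card {z' \<in> U. \<Phi> z' = y} \<le> 4 * totient n" if "y \<in> \<Phi> ` U" for y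
  proof -
    obtain u v where z: "(u, v) \<in> U" "y = \<Phi> (u, v)" using \<open>y \<in> \<Phi> ` U\<close> by auto
    obtain p q r s where pqrs: "B (u, v) = (p, q, r, s)" by (metis prod_cases4)
    have basis: "reduced_basis (int n) (int u) (int v) p q r s" using B[of u v] by (simp add: pqrs)
    have "coprime (int (u\<^sup>2 + v\<^sup>2)) (int n)"
      using z(1) by (simp only: U_def norm_units_def coprime_int_iff mem_Collect_eq prod.case simp_thms)
    then have cop: "coprime ((int u)\<^sup>2 + (int v)\<^sup>2) (int n)" by simp
    define H where "H = (\<lambda>((e, f), k). (nat ((int k * (e * int u - f * int v)) mod int n),
      nat ((int k * (f * int u + e * int v)) mod int n)))"
    have sub: "{z' \<in> U. \<Phi> z' = y} \<subseteq> H ` (T \<times> K)"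
    proof
      fix z' assume z': "z' \<in> {z' \<in> U. \<Phi> z' = y}"
      obtain u' v' where uv': "z' = (u', v')" by (cases z')
      have "u' < n" "v' < n" "coprime (u'\<^sup>2 + v'\<^sup>2) n" using z' by (auto simp: uv' U_def norm_units_def)
      obtain p' q' r' s' where pqrs': "B (u', v') = (p', q', r', s')" by (metis prod_cases4)
      have basis': "reduced_basis (int n) (int u') (int v') p' q' r' s'" using B[of u' v'] by (simp add: pqrs')
      have "\<Phi> (u', v') = \<Phi> (u, v)" using z' z(2) by (simp add: uv')
      then have "p\<^sup>2 + q\<^sup>2 = p'\<^sup>2 + q'\<^sup>2" "p * r + q * s = p' * r' + q' * s'"
        by (simp_all add: \<Phi>_def pqrs pqrs')
      then obtain e f k where efk: "(e, f) \<in> {(1, 0), (0, 1), (-1, 0), (0, -1)}"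
        "int n dvd int u' - k * (e * int u - f * int v)" "int n dvd int v' - k * (f * int u + e * int v)"
        using same_gram_matrix_imp_rotation[OF basis basis' _ cop] assms(1) by auto
      define k' where "k' = nat (k mod int n)"
      have k': "int k' = k mod int n" using assms(1) by (simp add: k'_def)
      have red: "w = nat ((int k' * c) mod int n)" if "int n dvd int w - k * c" "w < n" for w c
      proof -
        have "int w mod int n = (k * c) mod int n" using that(1) by (simp add: mod_eq_dvd_iff)
        also have "\<dots> = (int k' * c) mod int n" unfolding k' by (simp add: mod_mult_left_eq)
        finally have "(int k' * c) mod int n = int w" using that(2) by simp
        then show ?thesis by simp
      qed
      \<comment> \<open>A common divisor of k and n would divide both u' and v', hence a norm prime
        to n.\<close>
      have "coprime k (int n)"
      proof (rule coprimeI)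
        fix d assume d: "d dvd k" "d dvd int n"
        have "d dvd int u' - k * (e * int u - f * int v)" "d dvd int v' - k * (f * int u + e * int v)"
          using efk(2,3) d(2) dvd_trans by blast+
        then have "d dvd int u'" "d dvd int v'"
          using d(1) by (metis dvd_diff_right_iff dvd_mult2 diff_diff_eq2 dvd_add_left_iff diff_add_cancel)+
        then have "d dvd int (u'\<^sup>2 + v'\<^sup>2)" by (simp add: power2_eq_square)
        moreover have "coprime (int (u'\<^sup>2 + v'\<^sup>2)) (int n)"
          using \<open>coprime (u'\<^sup>2 + v'\<^sup>2) n\<close> by (simp only: coprime_int_iff)
        ultimately show "is_unit d" using d(2) coprime_common_divisor by blast
      qed
      then have "coprime (int k') (int n)" using assms(1) by (simp add: k' coprime_mod_left_iff)
      moreover have "int k' < int n" using assms(1) by (simp add: k')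
      ultimately have "k' \<in> K" by (simp add: K_def)
      moreover have "z' = H ((e, f), k')"
        using red[OF efk(2) \<open>u' < n\<close>] red[OF efk(3) \<open>v' < n\<close>] by (simp add: H_def uv')
      moreover have "(e, f) \<in> T" using efk(1) by (simp add: T_def)
      ultimately show "z' \<in> H ` (T \<times> K)" by blast
    qed
    have "card {z' \<in> U. \<Phi> z' = y} \<le> card (T \<times> K)"
      using sub by (rule surj_card_le[rotated]) (simp add: T_def finK)
    also have "\<dots> = 4 * card K" by (simp add: card_cartesian_product T_def)
    finally show ?thesis using cardK by simp
  qed
  then have "card U \<le> 4 * totient n * card (\<Phi> ` U)"
    by (intro card_le_mult_card_image) (auto simp: U_def)
  moreover have "card (\<Phi> ` U) \<le> 2 * card R"
  proof -
    let ?f = "\<lambda>(x, m, y). (x, m) :: int \<times> int" and ?g = "\<lambda>(x, m, y). (x, - m) :: int \<times> int"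
    have "\<Phi> ` U \<subseteq> ?f ` R \<union> ?g ` R"
    proof (rule image_subsetI)
      fix z assume "z \<in> U"
      obtain u v where z: "z = (u, v)" by (cases z)
      obtain p q r s where pqrs: "B (u, v) = (p, q, r, s)" by (metis prod_cases4)
      have basis: "reduced_basis (int n) (int u) (int v) p q r s" using B[of u v] by (simp add: pqrs)
      have "coprime (int (u\<^sup>2 + v\<^sup>2)) (int n)"
        using \<open>z \<in> U\<close> by (simp only: z U_def norm_units_def coprime_int_iff mem_Collect_eq prod.case simp_thms)
      then have "(p\<^sup>2 + q\<^sup>2, \<bar>p * r + q * s\<bar>, r\<^sup>2 + s\<^sup>2) \<in> R"
        unfolding R_def using assms(1) by (intro reduced_basis_form[OF basis]) auto
      moreover have "\<Phi> z = (p\<^sup>2 + q\<^sup>2, p * r + q * s)" by (simp add: \<Phi>_def z pqrs)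
      ultimately show "\<Phi> z \<in> ?f ` R \<union> ?g ` R"
        by (cases "p * r + q * s \<ge> 0") (force simp: image_iff)+
    qed
    then have "card (\<Phi> ` U) \<le> card (?f ` R \<union> ?g ` R)"
      using assms(2) by (intro card_mono) (auto simp: R_def)
    also have "\<dots> \<le> card (?f ` R) + card (?g ` R)" by (rule card_Un_le)
    also have "\<dots> \<le> card R + card R"
      using assms(2) by (intro add_mono card_image_le) (auto simp: R_def)
    finally show ?thesis by simp
  qed
  ultimately have "card U \<le> 4 * totient n * (2 * card R)"
    by (meson le_trans mult_le_mono2)
  moreover have "(totient n)\<^sup>2 \<le> card U"
    unfolding U_def using assms(1) by (intro totient_squared_le_card_norm_units) simp
  ultimately have "totient n * totient n \<le> 4 * totient n * (2 * card R)"
    unfolding power2_eq_square by (rule le_trans[rotated])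
  also have "\<dots> = totient n * (8 * card R)" by simp
  finally have "totient n * totient n \<le> totient n * (8 * card R)" .
  moreover have "totient n > 0" using assms(1) by simp
  ultimately show ?thesis unfolding R_def using mult_le_cancel1 by blast
qed

theorem theorem4p4:
  "\<exists>C\<^sub>1 C\<^sub>2 :: real. C\<^sub>1 > 0 \<and> C\<^sub>2 > 0 \<and>
     (\<forall>n::int. n \<ge> 3 \<longrightarrow>
        C\<^sub>1 * (real_of_int n / ln (ln (real_of_int n))) < real (N_root_star (- n)) \<and>
        real (N_root_star (- n)) < C\<^sub>2 * (real_of_int n * ln (ln (real_of_int n))))"
proof -
  obtain C where C: "C > 0" "\<And>n. n \<ge> 3 \<Longrightarrow> prime_factor_prod n \<le> C * ln (ln (real n))"
    using prime_factor_prod_bound by blast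
  \<comment> \<open>The estimates give the constants 8 C and 18 C; 16 and 19 make both inequalities
    strict.\<close>
  have "1 / (16 * C) * (real_of_int n / ln (ln (real_of_int n))) < real (N_root_star (- n)) \<and>
      real (N_root_star (- n)) < 19 * C * (real_of_int n * ln (ln (real_of_int n)))" if "n \<ge> 3" for n :: int
  proof -
    define k where "k = nat n"
    have k: "k \<ge> 3" "n = int k" "real_of_int n = real k" using that by (auto simp: k_def)
    define l where "l = ln (ln (real k))"
    define N where "N = card (reduced_forms (int k))"
    have P: "prime_factor_prod k \<le> C * l" using C(2) k(1) by (simp add: l_def)
    have fin: "finite (reduced_forms (int k))" using card_reduced_forms_le(1) k(1) by simp
    have tot: "real (totient k) * prime_factor_prod k = real k"
      by (rule totient_times_prime_factor_prod)
    have totpos: "real (totient k) > 0" using k(1) by simp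
    \<comment> \<open>Positivity of ln (ln k) is read off from the positive product that it
      bounds.\<close>
    have "real (totient k) * prime_factor_prod k > 0" using tot k(1) by simp
    then have "prime_factor_prod k > 0" using totpos by (simp add: zero_less_mult_iff)
    then have l0: "l > 0" using P C(1) by (smt (verit) zero_less_mult_iff)
    have "real k \<le> real (totient k) * (C * l)"
      unfolding tot[symmetric] using P by (intro mult_left_mono) auto
    also have "\<dots> \<le> real (8 * N) * (C * l)"
      using totient_le_card_reduced_forms[of k] k(1) fin C(1) l0
      by (intro mult_right_mono) (auto simp: N_def simp flip: of_nat_mult)
    also have "\<dots> = 8 * C * l * real N" by simp
    finally have lower: "real k \<le> 8 * C * l * real N" .
    then have N0: "real N > 0" using k(1) C(1) l0 by (cases "N = 0") auto
    have "1 / (16 * C) * (real k / l) \<le> 1 / (16 * C) * (8 * C * l * real N / l)"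
      using lower C(1) l0 by (intro mult_left_mono divide_right_mono) auto
    also have "\<dots> = real N / 2" using C(1) l0 by simp
    also have "\<dots> < real N" using N0 by simp
    finally have 1: "1 / (16 * C) * (real k / l) < real N" .
    have "real N \<le> 18 * real k * (\<Sum>g | g dvd k. 1 / real g)"
      unfolding N_def using card_reduced_forms_le(2) k(1) by simp
    also have "\<dots> \<le> 18 * real k * (C * l)"
      using sum_inverse_divisors_le_prime_factor_prod[of k] P k(1) by (intro mult_left_mono) auto
    also have "\<dots> < 19 * C * (real k * l)" using C(1) l0 k(1) by simp
    finally have 2: "real N < 19 * C * (real k * l)" .
    have "N_root_star (- n) = N"
      unfolding k(2) N_def using k(1) by (intro N_root_star_eq_card_reduced_forms) simp
    then show ?thesis using 1 2 by (simp only: k(3) l_def)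
  qed
  then show ?thesis using C(1) by (intro exI[of _ "1 / (16 * C)"] exI[of _ "19 * C"]) simp
qed

end
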